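(* Given on input a target tolerance $\epsilon>0$, the NERML algorithm (with control parameters $\gamma,\theta\in(0,1)$ and a positive integer $m$) applied to the vector field $g$ terminates after finitely many steps, producing an execution protocol $y^t=\{y_\tau,g(y_\tau)\}_{\tau=1}^t$, where $t$ is the step where the algorithm terminates and $y_1,\dots,y_t\in Y$ are the search points generated in the course of the run, and an accuracy certificate $\lambda^t$, i.e. a collection of nonnegative weights $\lambda_1,\dots,\lambda_t$ summing up to 1, such that $$\epsilon(y^t,\lambda^t):=\max_{y\in Y}\sum_{\tau=1}^t\lambda_\tau\langle g(y_\tau),y_\tau-y\rangle\le\epsilon .$$ The number of steps of the algorithm does not exceed $$N=C(\gamma,\theta)\,\frac{\Omega^2L^2[g]}{\epsilon^2},\qquad\text{where}\quad C(\gamma,\theta)=\frac{1+\gamma^2}{\gamma^2\left[1-[\gamma+(1-\gamma)\theta]^2\right]} .$$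
   Context: Setup. $E_y$ is a Euclidean space with inner product $\langle\cdot,\cdot\rangle$, $Y\subset E_y$ is a nonempty convex compact set, $\|\cdot\|$ is a norm on $E_y$ with conjugate (dual) norm $\|\cdot\|_*$. $\omega:Y\to\mathbf{R}$ is a distance-generating function: it is continuous and convex on $Y$, admits a selection $\omega'(y)\in\partial\omega(y)$ of subgradients that is continuous in $y\in Y^o:=\{y\in Y:\partial\omega(y)\ne\emptyset\}$, and satisfies $\langle\omega'(y)-\omega'(y'),y-y'\rangle\ge\|y-y'\|^2$ for all $y,y'\in Y^o$. Put $y_\omega=\mathrm{argmin}_{y\in Y}\omega(y)$ and $\Omega=\Omega[Y,\omega(\cdot)]:=\sqrt{2[\max_{Y}\omega-\min_{Y}\omega]}$. The vector field $g:Y\to E_y$ is bounded: $\|g(y)\|_*\le L[g]<\infty$ for all $y\in Y$ (no other assumption on $g$ is made). For $y\in Y$ let $h_y(z)=\langle g(y),y-z\rangle$; for a finite set $S\subset Y$ let $\mathcal{F}_S$ be the set of convex combinations of the affine functions $h_y(\cdot)$, $y\in S$. Functions in $\mathcal{F}_S$ are always stored together with the weights of such a convex combination. NERML algorithm. Parameters: tolerance $\epsilon>0$, $\gamma,\theta\in(0,1)$, integer $m\ge1$. It builds search points $y_1,y_2,\dots\in Y$. A. Initialization. Set $y_1=y_\omega$, compute $g(y_1)$ and $f_1=\max_{y\in Y}h_{y_1}(y)\ge0$. If $f_1=0$, terminate with output $h_{y_1}$. If $f_1>0$, set $h^1=h_{y_1}$ and go to phase $s=1$. B. Phase $s=1,2,\dots$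 At its beginning we have the set $S^s=\{y_1,\dots,y_{t_s}\}$ of all search points built so far and $h^s\in\mathcal{F}_{S^s}$ with $f_s=\max_{y\in Y}h^s(y)\in(0,f_1]$. Set $\ell_s=\gamma f_s$. Search points generated at phase $s$ are denoted $u_1,u_2,\dots$, so that $y_{t_s+\tau}=u_\tau$. Initializing phase $s$: choose (arbitrarily) functions $h^s_{0,j}\in\mathcal{F}_{S^s}$, $1\le j\le m$, such that the closure of $\{y\in Y:h^s_{0,j}(y)>\ell_s,\ 1\le j\le m\}$ is nonempty (for instance, all equal to $h^s$), and set $u_1=y_\omega$. Step $\tau=1,2,\dots$ of phase $s$: given $u_\tau$ and $h^s_{\tau-1,1},\dots,h^s_{\tau-1,m}$, (1) compute $g(u_\tau)$ and set $h^s_{\tau-1,m+1}(y)=\langle g(u_\tau),u_\tau-y\rangle$. (2) Solve $\mathrm{Opt}=\max_{y\in Y}\min_{1\le j\le m+1}h^s_{\tau-1,j}(y)$, obtaining weights $\lambda^\tau_j\ge0$, $\sum_{j=1}^{m+1}\lambda_j^\tau=1$, such that $h^{s,\tau}:=\sum_{j=1}^{m+1}\lambda^\tau_jh^s_{\tau-1,j}$ satisfies $\max_{y\in Y}h^{s,\tau}(y)=\mathrm{Opt}$. (3) Case A: if $\mathrm{Opt}\le\epsilon$, terminate the algorithm with output $h^{s,\tau}$. Case B: otherwise, if $\mathrm{Opt}<\ell_s+\theta(f_s-\ell_s)$, terminate phase $s$ and start phase $s+1$ with $h^{s+1}=h^{s,\tau}$, $f_{s+1}=\mathrm{Opt}$.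 Case C: otherwise continue with (4). (4) Set $Y_\tau=\{y\in Y:h^s_{\tau-1,j}(y)\ge\ell_s,\ 1\le j\le m+1\}$ and $u_{\tau+1}=\mathrm{argmin}_{y\in Y_\tau}\omega(y)$. By optimality conditions there are $\mu_j\ge0$ with $\mu_j[h^s_{\tau-1,j}(u_{\tau+1})-\ell_s]=0$, $1\le j\le m+1$, such that $\langle\omega'(u_{\tau+1})-\sum_j\mu_j\nabla h^s_{\tau-1,j},\,y-u_{\tau+1}\rangle\ge0$ for all $y\in Y$; take such $\mu_j$ and let $\mu=\sum_j\mu_j$. If $\mu>0$, set $h^s_{\tau,1}=\mu^{-1}\sum_{j=1}^{m+1}\mu_jh^s_{\tau-1,j}$, discard two arbitrarily chosen elements of $\{h^s_{\tau-1,j}\}_{j=1}^{m+1}$, and let $h^s_{\tau,2},\dots,h^s_{\tau,m}$ be the remaining $m-1$ ones. If $\mu=0$, discard one arbitrarily chosen element of $\{h^s_{\tau-1,j}\}_{j=1}^{m+1}$ and let $\{h^s_{\tau,j}\}_{j=1}^m$ be the remaining ones. Pass to step $\tau+1$ of phase $s$. Upon termination, the output function is a convex combination $h(y)=\sum_{\tau=1}^t\lambda_\tau\langle g(y_\tau),y_\tau-y\rangle$, where $y_1,\dots,y_t$ are the search points generated; the execution protocol is $y^t=\{y_\tau,g(y_\tau)\}_{\tau=1}^t$ and the certificate is $\lambda^t=(\lambda_1,\dots,\lambda_t)$.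
   Formalization: The number of steps, counted as search points including the first, is bounded by max(2, N) instead of N, because N tends to 0 for large tolerance while the algorithm always builds one search point, and a second unless it stops at initialization. *)

theory Defs
  imports "HOL-Analysis.Analysis"
begin

section \<open>Geometry\<close>

text \<open>The norm is not the Euclidean norm of the type, so it is an explicit function.\<close>

definition is_norm :: "('a::real_vector \<Rightarrow> real) \<Rightarrow> bool" where
  "is_norm nrm \<longleftrightarrow>
     (\<forall>x. 0 \<le> nrm x) \<and> (\<forall>x. nrm x = 0 \<longleftrightarrow> x = 0) \<and>
     (\<forall>c x. nrm (c *\<^sub>R x) = \<bar>c\<bar> * nrm x) \<and> (\<forall>x y. nrm (x + y) \<le> nrm x + nrm y)"

definition dual_norm :: "('a::euclidean_space \<Rightarrow> real) \<Rightarrow> 'a \<Rightarrow> real" where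
  "dual_norm nrm p = (SUP x\<in>{x. nrm x \<le> 1}. p \<bullet> x)"

definition subdiff :: "'a::euclidean_space set \<Rightarrow> ('a \<Rightarrow> real) \<Rightarrow> 'a \<Rightarrow> 'a set" where
  "subdiff Y \<omega> y = {p. \<forall>z\<in>Y. \<omega> z \<ge> \<omega> y + p \<bullet> (z - y)}"

definition subdiff_dom :: "'a::euclidean_space set \<Rightarrow> ('a \<Rightarrow> real) \<Rightarrow> 'a set" where
  "subdiff_dom Y \<omega> = {y\<in>Y. subdiff Y \<omega> y \<noteq> {}}"

text \<open>Only the values of \<open>\<omega>'\<close> on \<open>subdiff_dom Y \<omega>\<close> are constrained.\<close>

definition dgf ::
  "'a::euclidean_space set \<Rightarrow> ('a \<Rightarrow> real) \<Rightarrow> ('a \<Rightarrow> real) \<Rightarrow> ('a \<Rightarrow> 'a) \<Rightarrow> bool" where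
  "dgf Y nrm \<omega> \<omega>' \<longleftrightarrow>
     continuous_on Y \<omega> \<and> convex_on Y \<omega> \<and>
     (\<forall>y\<in>subdiff_dom Y \<omega>. \<omega>' y \<in> subdiff Y \<omega> y) \<and>
     continuous_on (subdiff_dom Y \<omega>) \<omega>' \<and>
     (\<forall>y\<in>subdiff_dom Y \<omega>. \<forall>y'\<in>subdiff_dom Y \<omega>.
        (\<omega>' y - \<omega>' y') \<bullet> (y - y') \<ge> (nrm (y - y'))\<^sup>2)"

definition dgf_width :: "'a::euclidean_space set \<Rightarrow> ('a \<Rightarrow> real) \<Rightarrow> real" where
  "dgf_width Y \<omega> = sqrt (2 * ((SUP y\<in>Y. \<omega> y) - (INF y\<in>Y. \<omega> y)))"


section \<open>Protocols and weights\<close>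

text \<open>
  A protocol is the list of the pairs \<open>(y, g y)\<close> for the search points built so far; indices
  start at 0.  A function stored by the algorithm is represented by its weights on the entries
  of the protocol.  Weights vanish beyond the end of the protocol, so they represent the same
  function after the protocol has been extended.
\<close>

type_synonym 'a protocol = "('a \<times> 'a) list"
type_synonym weights = "nat \<Rightarrow> real"

definition is_weights :: "nat \<Rightarrow> weights \<Rightarrow> bool" where
  "is_weights t c \<longleftrightarrow> (\<forall>i. 0 \<le> c i) \<and> (\<forall>i\<ge>t. c i = 0) \<and> (\<Sum>i<t. c i) = 1"

definition unit_weight :: "nat \<Rightarrow> weights" where
  "unit_weight k = (\<lambda>i. if i = k then 1 else 0)"

definition comb_fun :: "'a::euclidean_space protocol \<Rightarrow> weights \<Rightarrow> 'a \<Rightarrow> real" where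
  "comb_fun P c z = (\<Sum>i<length P. c i * (snd (P ! i) \<bullet> (fst (P ! i) - z)))"

text \<open>The gradient of the affine function \<open>comb_fun P c\<close>.\<close>

definition comb_grad :: "'a::euclidean_space protocol \<Rightarrow> weights \<Rightarrow> 'a" where
  "comb_grad P c = - (\<Sum>i<length P. c i *\<^sub>R snd (P ! i))"

text \<open>Here \<open>Y\<close> will be compact and nonempty, so that the supremum is a maximum.\<close>

definition residual :: "'a::euclidean_space set \<Rightarrow> 'a protocol \<Rightarrow> weights \<Rightarrow> real" where
  "residual Y P c = (SUP y\<in>Y. comb_fun P c y)"


section \<open>The algorithm\<close>

text \<open>
  \<^item> \<open>Phase P w f\<close>: beginning of a phase, with protocol \<open>P\<close>, \<open>h\<^sup>s = comb_fun P w\<close> and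
    \<open>f\<^sub>s = f\<close>.
  \<^item> \<open>Step P f u H\<close>: beginning of a step of a phase with \<open>f\<^sub>s = f\<close>.  The current search point
    \<open>u\<close> is not yet in \<open>P\<close>; the current functions are given by the weights \<open>H j\<close>,
    \<open>1 \<le> j \<le> m\<close>, and values of \<open>H\<close> at other indices are irrelevant.
  \<^item> \<open>Halt P w\<close>: the algorithm has terminated with protocol \<open>P\<close> and output \<open>comb_fun P w\<close>.

  Every step appends exactly one entry to the protocol, and so does the initialization.  Hence
  the length of the final protocol is the number \<open>t\<close> of steps, initialization included.
\<close>

datatype 'a nerml_state =
    Phase "'a protocol" weights real
  | Step "'a protocol" real 'a "nat \<Rightarrow> weights"
  | Halt "'a protocol" weights

fun halted :: "'a nerml_state \<Rightarrow> bool" where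
  "halted (Halt P w) = True"
| "halted _ = False"

definition nerml_start ::
  "'a::euclidean_space set \<Rightarrow> ('a \<Rightarrow> real) \<Rightarrow> ('a \<Rightarrow> 'a) \<Rightarrow> 'a nerml_state" where
  "nerml_start Y \<omega> g =
     (let y1 = arg_min_on \<omega> Y; P = [(y1, g y1)]; w = unit_weight 0; f1 = residual Y P w
      in if f1 = 0 then Halt P w else Phase P w f1)"

definition opt_value ::
  "'a::euclidean_space set \<Rightarrow> nat \<Rightarrow> 'a protocol \<Rightarrow> (nat \<Rightarrow> weights) \<Rightarrow> real" where
  "opt_value Y n P H = (SUP y\<in>Y. MIN j\<in>{1..n}. comb_fun P (H j) y)"

text \<open>
  \<open>c\<close> is obtained from some optimal multipliers of the max-min problem.
\<close>

definition opt_comb ::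
  "'a::euclidean_space set \<Rightarrow> nat \<Rightarrow> 'a protocol \<Rightarrow> (nat \<Rightarrow> weights) \<Rightarrow> weights \<Rightarrow> bool" where
  "opt_comb Y n P H c \<longleftrightarrow>
     (\<exists>lam. (\<forall>j\<in>{1..n}. 0 \<le> lam j) \<and> (\<Sum>j=1..n. lam j) = (1::real) \<and>
          c = (\<lambda>i. \<Sum>j=1..n. lam j * H j i) \<and>
          residual Y P c = opt_value Y n P H)"

definition level_set ::
  "'a::euclidean_space set \<Rightarrow> nat \<Rightarrow> 'a protocol \<Rightarrow> (nat \<Rightarrow> weights) \<Rightarrow> real \<Rightarrow> 'a set" where
  "level_set Y n P H l = {y\<in>Y. \<forall>j\<in>{1..n}. comb_fun P (H j) y \<ge> l}"

definition kkt_mult ::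
  "'a::euclidean_space set \<Rightarrow> ('a \<Rightarrow> 'a) \<Rightarrow> nat \<Rightarrow> 'a protocol \<Rightarrow> (nat \<Rightarrow> weights) \<Rightarrow> real \<Rightarrow> 'a
     \<Rightarrow> (nat \<Rightarrow> real) \<Rightarrow> bool" where
  "kkt_mult Y \<omega>' n P H l u \<mu> \<longleftrightarrow>
     (\<forall>j\<in>{1..n}. 0 \<le> \<mu> j \<and> \<mu> j * (comb_fun P (H j) u - l) = 0) \<and>
     (\<forall>y\<in>Y. 0 \<le> (\<omega>' u - (\<Sum>j=1..n. \<mu> j *\<^sub>R comb_grad P (H j))) \<bullet> (y - u))"

text \<open>
  From the \<open>m + 1\<close> functions \<open>H\<close> to the next \<open>m\<close> functions \<open>H'\<close>.  Discarding arbitrary elements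
  of the indexed family (and numbering the remaining ones) is expressed by an injection \<open>\<pi>\<close> of
  the new indices into the old ones.
\<close>

definition bundle_update ::
  "nat \<Rightarrow> (nat \<Rightarrow> real) \<Rightarrow> (nat \<Rightarrow> weights) \<Rightarrow> (nat \<Rightarrow> weights) \<Rightarrow> bool" where
  "bundle_update m \<mu> H H' \<longleftrightarrow>
     (let M = (\<Sum>j=1..m+1. \<mu> j) in
      if M > 0 then
        H' 1 = (\<lambda>i. (\<Sum>j=1..m+1. \<mu> j * H j i) / M) \<and>
        (\<exists>\<pi>. inj_on \<pi> {2..m} \<and> \<pi> ` {2..m} \<subseteq> {1..m+1} \<and> (\<forall>j\<in>{2..m}. H' j = H (\<pi> j)))
      else
        (\<exists>\<pi>. inj_on \<pi> {1..m} \<and> \<pi> ` {1..m} \<subseteq> {1..m+1} \<and> (\<forall>j\<in>{1..m}. H' j = H (\<pi> j))))"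

text \<open>
  One transition.  All choices left open by the algorithm are nondeterministic.
\<close>

inductive nerml_trans ::
  "'a::euclidean_space set \<Rightarrow> ('a \<Rightarrow> real) \<Rightarrow> ('a \<Rightarrow> 'a) \<Rightarrow> ('a \<Rightarrow> 'a) \<Rightarrow> real \<Rightarrow> real \<Rightarrow> real \<Rightarrow> nat
     \<Rightarrow> 'a nerml_state \<Rightarrow> 'a nerml_state \<Rightarrow> bool"
  for Y :: "'a set" and \<omega> :: "'a \<Rightarrow> real" and \<omega>' g :: "'a \<Rightarrow> 'a"
    and \<epsilon> \<gamma> \<theta> :: real and m :: nat
where
  init_phase:
    "\<lbrakk> \<forall>j\<in>{1..m}. is_weights (length P) (H j);
       closure {y\<in>Y. \<forall>j\<in>{1..m}. comb_fun P (H j) y > \<gamma> * f} \<noteq> {} \<rbrakk>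
     \<Longrightarrow> nerml_trans Y \<omega> \<omega>' g \<epsilon> \<gamma> \<theta> m (Phase P w f) (Step P f (arg_min_on \<omega> Y) H)"
| case_A:
    "\<lbrakk> P' = P @ [(u, g u)]; H' = H(m + 1 := unit_weight (length P));
       opt_comb Y (m + 1) P' H' c;
       opt_value Y (m + 1) P' H' \<le> \<epsilon> \<rbrakk>
     \<Longrightarrow> nerml_trans Y \<omega> \<omega>' g \<epsilon> \<gamma> \<theta> m (Step P f u H) (Halt P' c)"
| case_B:
    "\<lbrakk> P' = P @ [(u, g u)]; H' = H(m + 1 := unit_weight (length P)); l = \<gamma> * f;
       opt_comb Y (m + 1) P' H' c;
       \<epsilon> < opt_value Y (m + 1) P' H';
       opt_value Y (m + 1) P' H' < l + \<theta> * (f - l) \<rbrakk>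
     \<Longrightarrow> nerml_trans Y \<omega> \<omega>' g \<epsilon> \<gamma> \<theta> m
           (Step P f u H) (Phase P' c (opt_value Y (m + 1) P' H'))"
| case_C:
    "\<lbrakk> P' = P @ [(u, g u)]; H' = H(m + 1 := unit_weight (length P)); l = \<gamma> * f;
       \<epsilon> < opt_value Y (m + 1) P' H';
       l + \<theta> * (f - l) \<le> opt_value Y (m + 1) P' H';
       u' = arg_min_on \<omega> (level_set Y (m + 1) P' H' l);
       kkt_mult Y \<omega>' (m + 1) P' H' l u' \<mu>;
       bundle_update m \<mu> H' H'' \<rbrakk>
     \<Longrightarrow> nerml_trans Y \<omega> \<omega>' g \<epsilon> \<gamma> \<theta> m (Step P f u H) (Step P' f u' H'')"

definition nerml_const :: "real \<Rightarrow> real \<Rightarrow> real" where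
  "nerml_const \<gamma> \<theta> = (1 + \<gamma>\<^sup>2) / (\<gamma>\<^sup>2 * (1 - (\<gamma> + (1 - \<gamma>) * \<theta>)\<^sup>2))"

text \<open>
  \<open>nerml_bound\<close> tends to 0 as \<open>\<epsilon>\<close> grows, whereas every run builds the point \<open>y\<^sub>1\<close>, and a second
  one unless \<open>f\<^sub>1 = 0\<close>.  So \<open>t \<le> nerml_bound\<close> can only be claimed when the bound is at least 2;
  example: \<open>Y = [0,1]\<close>, \<open>\<omega> y = y\<^sup>2/2\<close>, \<open>g = -1\<close>, \<open>\<Omega> = L = f\<^sub>1 = 1\<close>, \<open>t = 2\<close> and large \<open>\<epsilon>\<close>.
  This is why \<open>max 2\<close> is used when the bound is stated.  It has an effect only for
  \<open>\<epsilon> > \<Omega> L\<close>, as otherwise the bound exceeds 5.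
\<close>

definition nerml_bound :: "real \<Rightarrow> real \<Rightarrow> real \<Rightarrow> real \<Rightarrow> real \<Rightarrow> real" where
  "nerml_bound \<gamma> \<theta> \<Omega> L \<epsilon> = nerml_const \<gamma> \<theta> * (\<Omega>\<^sup>2 * L\<^sup>2 / \<epsilon>\<^sup>2)"

end

theory Submission
  imports Defs
begin

text \<open>
  Within a phase the prox-centers \<open>u\<close> climb along \<open>\<omega>\<close>. The new center satisfies every bundle
  inequality \<open>h \<ge> \<ell>\<close>, where \<open>\<ell> = \<gamma> f\<close>, including the cut \<open>\<langle>g u, u - y\<rangle> \<ge> \<ell>\<close> at the
  old center \<open>u\<close>, so it lies at distance at least \<open>\<ell> / L\<close> from \<open>u\<close>. The old center is
  stationary for \<open>\<omega>\<close> relative to the bundle (this is what aggregation with the multipliers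
  preserves), so strong convexity makes \<open>\<omega>\<close> grow by at least \<open>\<ell>\<^sup>2 / (2 L\<^sup>2)\<close> from one center to
  the next. As \<open>\<omega>\<close> varies by \<open>\<Omega>\<^sup>2 / 2\<close> only, a phase with gap \<open>f\<close> has at most
  \<open>\<Omega>\<^sup>2 L\<^sup>2 / (\<gamma>\<^sup>2 f\<^sup>2) + 1\<close> steps. Since \<open>f \<le> \<Omega> L\<close>, this is at most \<open>(1 + 1 / \<gamma>\<^sup>2) R\<close>
  with \<open>R = (\<Omega> L / f)\<^sup>2\<close>. Each new phase shrinks \<open>f\<close> by a factor below
  \<open>\<kappa> = \<gamma> + (1 - \<gamma>) \<theta> < 1\<close>, so the phase lengths are dominated by a geometric series with
  ratio \<open>\<kappa>\<^sup>2\<close> ending at a gap above \<open>\<epsilon>\<close>, and its sum is the claimed bound. The part of that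
  series that precedes the first phase pays for the search point of the initialization. If the
first gap is at most \<open>\<epsilon>\<close> already, the run ends at its second search point.

  Three facts from convex analysis are needed in a sharp form. Lagrange multipliers exist
  under Slater's condition (\<open>lagrange_multipliers\<close>); they give both the multipliers \<open>\<mu>\<close> of the
  prox-step and, in \<open>Y \<times> \<real>\<close>, the weights of the max-min problem, hence an algorithm that never
  gets stuck. The optimality condition must hold for the prescribed selection \<open>\<omega>'\<close>, not just
  for some subgradient (\<open>selection_dominates\<close>): this is where continuity of the selection
  enters. Strong convexity of \<open>\<omega>\<close> has to be derived from monotonicity of \<open>\<omega>'\<close> on a set that
  may fail to be convex (\<open>dgf_growth\<close>).

  All three claims of the theorem then follow from one invariant of the reachable states
  (\<open>invariant_start\<close>, \<open>invariant_step\<close>): it contains the step count, it bounds the length of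
  every run, and it supplies the Slater points that \<open>progress\<close> needs.
\<close>

section \<open>Lagrange multipliers under the Slater condition\<close>

text \<open>
  Each point with \<open>h < 0\<close> forces a lower bound on the multiplier, and each point with \<open>h > 0\<close>
  an upper bound. The bounds are compatible, because the segment between two such points
  meets \<open>h \<ge> 0\<close> at the place where linear interpolation of \<open>h\<close> vanishes. Slater's condition
  provides one upper bound, so the supremum of the lower bounds exists and is a multiplier.
\<close>
lemma lagrange_multiplier_single:
  fixes S :: "'b::real_vector set" and \<phi> h :: "'b \<Rightarrow> real"
  assumes \<phi>: "convex_on S \<phi>" and h: "concave_on S h"
    and u: "u \<in> S" "0 \<le> h u" and slater: "\<exists>z\<in>S. 0 < h z"
    and umin: "\<And>y. y \<in> S \<Longrightarrow> 0 \<le> h y \<Longrightarrow> \<phi> u \<le> \<phi> y"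
  shows "\<exists>\<mu>\<ge>0. \<mu> * h u = 0 \<and> (\<forall>y\<in>S. \<phi> u \<le> \<phi> y - \<mu> * h y)"
proof -
  have cross: "(\<phi> u - \<phi> y) * h z \<le> (\<phi> z - \<phi> u) * (- h y)"
    if y: "y \<in> S" "h y < 0" and z: "z \<in> S" "0 < h z" for y z
  proof -
    \<comment> \<open>At this parameter the linear interpolation of \<open>h\<close> between \<open>z\<close> and \<open>y\<close> vanishes.\<close>
    define s where "s = h z / (h z - h y)"
    have s: "0 \<le> s" "s \<le> 1" "1 - s = - h y / (h z - h y)" using y z by (auto simp: s_def field_simps)
    define x where "x = s *\<^sub>R y + (1 - s) *\<^sub>R z"
    have xS: "x \<in> S" using convexD[OF convex_on_imp_convex[OF \<phi>], of y z s "1 - s"] y z s(1,2) unfolding x_def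
      by simp
    have "s * h y + (1 - s) * h z \<le> h x"
      using concave_onD[OF h, of "1-s" y z] s(1,2) y z by (simp add: x_def)
    moreover have "s * h y + (1 - s) * h z = 0" unfolding s(3) by (simp add: s_def field_simps)
    ultimately have "\<phi> u \<le> \<phi> x" using umin xS by simp
    also have "\<dots> \<le> s * \<phi> y + (1 - s) * \<phi> z"
      using convex_onD[OF \<phi>, of "1-s" y z] s(1,2) y z by (simp add: x_def)
    finally have "\<phi> u * (h z - h y) \<le> (s * \<phi> y + (1 - s) * \<phi> z) * (h z - h y)"
      using y z by (intro mult_right_mono) auto
    also have "\<dots> = h z * \<phi> y - h y * \<phi> z" 
    proof -
      have "s * (h z - h y) = h z" "(1-s) * (h z - h y) = - h y" using y z s(3) by (auto simp: s_def)
      then have "h z = s * (h z - h y)" "- h y = (1 - s) * (h z - h y)" by auto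
      then show ?thesis by algebra
    qed
    finally show ?thesis by (simp add: algebra_simps)
  qed
  obtain z0 where z0: "z0 \<in> S" "0 < h z0" using slater by blast
  \<comment> \<open>The element 0 makes the supremum nonnegative and keeps the set nonempty.\<close>
  define A where "A = insert 0 ((\<lambda>y. (\<phi> u - \<phi> y) / (- h y)) ` {y\<in>S. h y < 0})"
  have ub: "a \<le> (\<phi> z - \<phi> u) / h z" if "a \<in> A" "z \<in> S" "0 < h z" for a z
    using that(1) unfolding A_def
  proof (elim insertE imageE CollectE conjE)
    assume "a = 0"
    then show ?thesis using umin[OF that(2)] that(3) by simp
  next
    fix y assume y: "a = (\<phi> u - \<phi> y) / (- h y)" "y \<in> S" "h y < 0"
    have "(\<phi> u - \<phi> y) / (- h y) \<le> (\<phi> z - \<phi> u) / h z"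
      using cross[OF y(2,3) that(2,3)] y(3) that(3)
      by (simp add: pos_divide_le_eq pos_le_divide_eq mult.commute del: divide_minus_right)
    then show ?thesis unfolding y(1) .
  qed
  have bdd: "bdd_above A" by (rule bdd_aboveI[of _ "(\<phi> z0 - \<phi> u) / h z0"]) (use ub z0 in blast)
  define \<mu> where "\<mu> = Sup A"
  have ge: "a \<le> \<mu>" if "a \<in> A" for a unfolding \<mu>_def using that bdd by (rule cSup_upper)
  have le: "\<mu> \<le> (\<phi> z - \<phi> u) / h z" if "z \<in> S" "0 < h z" for z
    unfolding \<mu>_def by (rule cSup_least) (use ub that in \<open>auto simp: A_def\<close>)
  have \<mu>0: "0 \<le> \<mu>" by (rule ge) (simp add: A_def)
  have slack: "\<mu> * h u = 0" using le[OF u(1)] u(2) \<mu>0 by (cases "h u = 0") auto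
  have "\<phi> u \<le> \<phi> y - \<mu> * h y" if y: "y \<in> S" for y
  proof (cases "h y" "0::real" rule: linorder_cases)
    case less
    then have "(\<phi> u - \<phi> y) / (- h y) \<le> \<mu>" using y by (intro ge) (auto simp: A_def)
    with less show ?thesis by (simp add: pos_divide_le_eq del: divide_minus_right)
  next
    case equal
    then show ?thesis using umin[OF y] by simp
  next
    case greater
    then show ?thesis using le[OF y] by (simp add: field_simps)
  qed
  with \<mu>0 slack show ?thesis by blast
qed

text \<open>
  Induction on the constraints: a multiplier for one of them, on the set cut out by the
  others, moves that constraint into the objective, which stays convex.
\<close>
lemma lagrange_multipliers:
  fixes S :: "'b::real_vector set" and \<phi> :: "'b \<Rightarrow> real" and h :: "'j \<Rightarrow> 'b \<Rightarrow> real"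
  assumes "finite J" and "convex_on S \<phi>" and "\<And>j. j \<in> J \<Longrightarrow> concave_on S (h j)"
    and "u \<in> S" "\<And>j. j \<in> J \<Longrightarrow> 0 \<le> h j u" and "\<exists>z\<in>S. \<forall>j\<in>J. 0 < h j z"
    and "\<And>y. y \<in> S \<Longrightarrow> (\<And>j. j \<in> J \<Longrightarrow> 0 \<le> h j y) \<Longrightarrow> \<phi> u \<le> \<phi> y"
  shows "\<exists>\<mu>. (\<forall>j\<in>J. 0 \<le> \<mu> j \<and> \<mu> j * h j u = 0) \<and> (\<forall>y\<in>S. \<phi> u \<le> \<phi> y - (\<Sum>j\<in>J. \<mu> j * h j y))"
  using assms
proof (induction J arbitrary: \<phi> rule: finite_induct)
  case empty
  then show ?case by simp
next
  case (insert k J)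
  define T where "T = {y\<in>S. \<forall>j\<in>J. 0 \<le> h j y}"
  have cS: "convex S" using convex_on_imp_convex[OF insert.prems(1)] .
  have cT: "convex T"
    unfolding convex_alt
  proof (intro ballI allI impI)
    fix x y and s :: real assume xy: "x \<in> T" "y \<in> T" and s: "0 \<le> s \<and> s \<le> 1"
    let ?w = "(1 - s) *\<^sub>R x + s *\<^sub>R y"
    have "0 \<le> h j ?w" if "j \<in> J" for j
    proof -
      have "(1 - s) * h j x + s * h j y \<le> h j ?w"
        using concave_onD[of S "h j" s x y] insert.prems(2)[of j] that xy s by (auto simp: T_def)
      moreover have "0 \<le> (1 - s) * h j x + s * h j y" using xy s that by (auto simp: T_def)
      ultimately show ?thesis by linarith
    qed
    moreover have "?w \<in> S" using cS xy s by (auto simp: T_def convex_alt)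
    ultimately show "?w \<in> T" by (simp add: T_def)
  qed
  have sub: "T \<subseteq> S" by (auto simp: T_def)
  obtain z where z: "z \<in> S" "\<forall>j\<in>insert k J. 0 < h j z" using insert.prems(5) by blast
  have zT: "z \<in> T" using z by (auto simp: T_def less_imp_le)
  have k: "concave_on T (h k)" using insert.prems(2)[of k] convex_on_subset[OF _ sub cT]
    by (simp add: concave_on_def)
  have "\<exists>\<mu>\<ge>0. \<mu> * h k u = 0 \<and> (\<forall>y\<in>T. \<phi> u \<le> \<phi> y - \<mu> * h k y)"
  proof (rule lagrange_multiplier_single[OF convex_on_subset[OF insert.prems(1) sub cT] k])
    show "u \<in> T" "0 \<le> h k u" using insert.prems(3,4) by (auto simp: T_def)
    show "\<exists>z\<in>T. 0 < h k z" using zT z by auto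
    show "\<phi> u \<le> \<phi> y" if "y \<in> T" "0 \<le> h k y" for y
      by (rule insert.prems(6)) (use that in \<open>auto simp: T_def\<close>)
  qed
  then obtain \<mu> where \<mu>: "\<mu> \<ge> 0" "\<mu> * h k u = 0" "\<forall>y\<in>T. \<phi> u \<le> \<phi> y - \<mu> * h k y" by blast
  define \<psi> where "\<psi> = (\<lambda>y. \<phi> y - \<mu> * h k y)"
  have "convex_on S (\<lambda>y. \<phi> y + \<mu> * (- h k y))"
    using insert.prems(1,2) \<mu>(1) by (intro convex_on_add convex_on_cmul) (auto simp: concave_on_def)
  then have c\<psi>: "convex_on S \<psi>" by (simp add: \<psi>_def)
  have "\<exists>\<nu>. (\<forall>j\<in>J. 0 \<le> \<nu> j \<and> \<nu> j * h j u = 0) \<and> (\<forall>y\<in>S. \<psi> u \<le> \<psi> y - (\<Sum>j\<in>J. \<nu> j * h j y))"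
    by (rule insert.IH[OF c\<psi>]) (use insert.prems \<mu> in \<open>auto simp: T_def \<psi>_def\<close>)
  then obtain \<nu> where \<nu>: "\<forall>j\<in>J. 0 \<le> \<nu> j \<and> \<nu> j * h j u = 0"
      "\<forall>y\<in>S. \<psi> u \<le> \<psi> y - (\<Sum>j\<in>J. \<nu> j * h j y)" by blast
  have eq: "(\<Sum>j\<in>J. (\<nu>(k := \<mu>)) j * h j y) = (\<Sum>j\<in>J. \<nu> j * h j y)" for y
    using insert.hyps by (intro sum.cong) auto
  have "\<forall>j\<in>insert k J. 0 \<le> (\<nu>(k := \<mu>)) j \<and> (\<nu>(k := \<mu>)) j * h j u = 0"
    using \<nu>(1) \<mu> by auto
  moreover have "\<forall>y\<in>S. \<phi> u \<le> \<phi> y - (\<Sum>j\<in>insert k J. (\<nu>(k := \<mu>)) j * h j y)"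
    unfolding sum.insert[OF insert.hyps] eq using \<nu>(2) \<mu>(2) by (auto simp: \<psi>_def algebra_simps)
  ultimately show ?case by blast
qed

section \<open>Norms and their duals\<close>

lemma norm_le_sum_Basis:
  fixes nrm :: "'a::euclidean_space \<Rightarrow> real"
  assumes "is_norm nrm"
  shows "nrm x \<le> (\<Sum>b\<in>Basis. nrm b) * norm x"
proof -
  have h: "nrm (c *\<^sub>R x) = \<bar>c\<bar> * nrm x" "nrm (x + y) \<le> nrm x + nrm y" "0 \<le> nrm x" "nrm 0 = 0" for c x y
    using assms by (auto simp: is_norm_def)
  have "nrm (\<Sum>b\<in>B. f b) \<le> (\<Sum>b\<in>B. nrm (f b))" if "finite B" for B :: "'a set" and f
    using that by induction (auto simp: h intro: order_trans[OF h(2)])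
  from this[of Basis "\<lambda>b. (x \<bullet> b) *\<^sub>R b"]
  have "nrm x \<le> (\<Sum>b\<in>Basis. \<bar>x \<bullet> b\<bar> * nrm b)" by (simp add: h euclidean_representation)
  also have "\<dots> \<le> (\<Sum>b\<in>Basis. norm x * nrm b)"
    by (intro sum_mono mult_right_mono h Basis_le_norm)
  finally show ?thesis by (simp add: sum_distrib_left mult.commute)
qed

text \<open>
  The norm is Lipschitz, hence attains a positive minimum on the Euclidean unit sphere.
\<close>
lemma norm_ge_euclidean:
  fixes nrm :: "'a::euclidean_space \<Rightarrow> real"
  assumes "is_norm nrm"
  obtains c where "0 < c" "\<And>x. c * norm x \<le> nrm x"
proof -
  have h: "nrm (c *\<^sub>R x) = \<bar>c\<bar> * nrm x" "nrm (x + y) \<le> nrm x + nrm y" "0 \<le> nrm x"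
     "nrm x = 0 \<longleftrightarrow> x = 0" for c x y
    using assms by (auto simp: is_norm_def)
  define C where "C = (\<Sum>b\<in>Basis. nrm (b::'a))"
  have C0: "0 \<le> C" unfolding C_def by (intro sum_nonneg h)
  have neg: "nrm (x - y) = nrm (y - x)" for x y using h(1)[of "-1" "y - x"] by simp
  have "nrm x \<le> nrm y + nrm (x - y)" for x y using h(2)[of y "x - y"] by simp
  then have lip: "\<bar>nrm x - nrm y\<bar> \<le> C * norm (x - y)" for x y
    using norm_le_sum_Basis[OF assms, of "x - y"] neg[of x y] unfolding C_def by (smt (verit))
  have "C-lipschitz_on UNIV nrm"
    by (rule lipschitz_onI) (use lip C0 in \<open>auto simp: dist_norm\<close>)
  then have cont: "continuous_on (sphere 0 1) nrm"
    using lipschitz_on_continuous_on continuous_on_subset by blast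
  obtain b :: 'a where b: "b \<in> Basis" using nonempty_Basis by blast
  then have "sphere (0::'a) 1 \<noteq> {}" by (auto intro!: exI[of _ b])
  from continuous_attains_inf[OF compact_sphere this cont]
  obtain x0 where x0: "x0 \<in> sphere 0 1" "\<And>y. y \<in> sphere 0 1 \<Longrightarrow> nrm x0 \<le> nrm y" by blast
  have p: "0 < nrm x0" using x0(1) h(3)[of x0] h(4)[of x0] by (auto simp: less_le)
  have "nrm x0 * norm x \<le> nrm x" for x
  proof (cases "x = 0")
    case False
    have "nrm x0 \<le> nrm (x /\<^sub>R norm x)" using False by (intro x0(2)) simp
    then show ?thesis using False by (simp add: h(1) field_simps)
  qed (simp add: h)
  with p that show thesis by blast
qed

text \<open>
  The generalized Cauchy-Schwarz inequality. Equivalence of norms makes the supremum that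
  defines the dual norm a bounded one.
\<close>
lemma dual_norm_ge:
  assumes "is_norm nrm"
  shows "p \<bullet> x \<le> dual_norm nrm p * nrm x"
proof -
  have h: "nrm (c *\<^sub>R x) = \<bar>c\<bar> * nrm x" "0 \<le> nrm x" "nrm x = 0 \<longleftrightarrow> x = 0" for c x
    using assms by (auto simp: is_norm_def)
  obtain c where c: "0 < c" "\<And>x. c * norm x \<le> nrm x" using norm_ge_euclidean[OF assms] by blast
  have bdd: "bdd_above ((\<lambda>x. p \<bullet> x) ` {x. nrm x \<le> 1})"
  proof (rule bdd_aboveI2)
    fix x assume "x \<in> {x. nrm x \<le> 1}"
    then have "norm x \<le> 1 / c" using c(2)[of x] c(1) by (simp add: field_simps)
    then show "p \<bullet> x \<le> norm p * (1 / c)"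
      using order_trans[OF norm_cauchy_schwarz] mult_left_mono norm_ge_zero by blast
  qed
  show ?thesis
  proof (cases "x = 0")
    case False
    then have pos: "0 < nrm x" using h by (simp add: less_le)
    have "p \<bullet> (x /\<^sub>R nrm x) \<le> dual_norm nrm p"
      unfolding dual_norm_def using pos by (intro cSUP_upper[OF _ bdd]) (simp add: h(1))
    with pos show ?thesis by (simp add: field_simps)
  next
    case True
    then have "nrm x = 0" using h(3) by blast
    with True show ?thesis by simp
  qed
qed

section \<open>Distance-generating functions\<close>

text \<open>
  Compare \<open>z\<close> with the points on the segment towards \<open>y\<close> and let the step \<open>s\<close> tend to zero:
  the term of second order disappears, and minus the gradient of the quadratic remains as a
  subgradient of \<open>\<omega>\<close> at \<open>z\<close>.
\<close>
lemma convex_min_variational: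
  fixes Y :: "'a::euclidean_space set"
  assumes cvx: "convex_on Y \<omega>" and z: "z \<in> Y" "y \<in> Y" and K: "0 \<le> K"
    and zmin: "\<And>x. x \<in> Y \<Longrightarrow> \<omega> z + K * (norm (z - v))\<^sup>2 \<le> \<omega> x + K * (norm (x - v))\<^sup>2"
  shows "\<omega> z + (- (2 * K) *\<^sub>R (z - v)) \<bullet> (y - z) \<le> \<omega> y"
proof -
  define A where "A = \<omega> y - \<omega> z + 2 * K * ((z - v) \<bullet> (y - z))"
  define D where "D = K * (norm (y - z))\<^sup>2"
  have ineq: "0 \<le> A + s * D" if s: "0 < s" "s \<le> 1" for s
  proof -
    define x where "x = (1 - s) *\<^sub>R z + s *\<^sub>R y"
    have xY: "x \<in> Y" using convex_on_imp_convex[OF cvx] z s by (simp add: x_def convex_alt)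
    have "(norm (x - v))\<^sup>2 = (norm ((z - v) + s *\<^sub>R (y - z)))\<^sup>2" by (simp add: x_def algebra_simps)
    also have "\<dots> = (norm (z - v))\<^sup>2 + 2 * s * ((z - v) \<bullet> (y - z)) + s\<^sup>2 * (norm (y - z))\<^sup>2"
      unfolding power2_norm_eq_inner by (simp add: inner_add_left inner_add_right inner_commute power2_eq_square)
    finally have "K * (norm (x - v))\<^sup>2 = K * (norm (z - v))\<^sup>2 + s * (2 * K * ((z - v) \<bullet> (y - z))) + s * (s * D)"
      unfolding D_def by algebra
    moreover have "\<omega> x \<le> (1 - s) * \<omega> z + s * \<omega> y"
      using convex_onD[OF cvx, of s z y] s z by (simp add: x_def)
    ultimately have "0 \<le> s * (A + s * D)" using zmin[OF xY] by (simp add: A_def algebra_simps)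
    then show ?thesis using s by (simp add: zero_le_mult_iff)
  qed
  have "((\<lambda>s. A + s * D) \<longlongrightarrow> A + 0 * D) (at_right 0)" by (intro tendsto_intros)
  moreover have "\<forall>\<^sub>F s in at_right 0. 0 \<le> A + s * D"
    unfolding eventually_at_right_field by (rule exI[of _ 1]) (auto intro: ineq)
  ultimately have "0 \<le> A + 0 * D" by (rule tendsto_lowerbound) simp
  then show ?thesis by (simp add: A_def)
qed

text \<open>
  Proximal points of \<open>v\<close> carry a subgradient by the preceding lemma and approach \<open>v\<close> as
  the weight \<open>K\<close> of the quadratic grows.
\<close>
lemma subdiff_dom_dense:
  fixes Y :: "'a::euclidean_space set"
  assumes Y: "compact Y" and cvx: "convex_on Y \<omega>" and cont: "continuous_on Y \<omega>"
    and v: "v \<in> Y" and e: "0 < e"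
  obtains z where "z \<in> subdiff_dom Y \<omega>" "norm (z - v) < e"
proof -
  have ne: "Y \<noteq> {}" using v by blast
  obtain x0 where x0: "x0 \<in> Y" "\<And>y. y \<in> Y \<Longrightarrow> \<omega> x0 \<le> \<omega> y"
    using continuous_attains_inf[OF Y ne cont] by blast
  \<comment> \<open>The proximal point satisfies \<open>K * (norm (z - v))\<^sup>2 \<le> \<omega> v - \<omega> x0\<close>.\<close>
  define K where "K = (\<omega> v - \<omega> x0 + 1) / e\<^sup>2"
  have K: "0 < K" using x0(2)[OF v] e by (simp add: K_def)
  have "continuous_on Y (\<lambda>x. \<omega> x + K * (norm (x - v))\<^sup>2)" by (intro continuous_intros cont)
  from continuous_attains_inf[OF Y ne this] obtain z where z: "z \<in> Y"
    "\<And>x. x \<in> Y \<Longrightarrow> \<omega> z + K * (norm (z - v))\<^sup>2 \<le> \<omega> x + K * (norm (x - v))\<^sup>2" by blast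
  have "- (2 * K) *\<^sub>R (z - v) \<in> subdiff Y \<omega> z"
    unfolding subdiff_def using convex_min_variational[OF cvx z(1) _ less_imp_le[OF K] z(2)] by auto
  then have "z \<in> subdiff_dom Y \<omega>" using z by (auto simp: subdiff_dom_def)
  moreover have "norm (z - v) < e"
  proof -
    have "K * (norm (z - v))\<^sup>2 \<le> \<omega> v - \<omega> x0" using z(2)[OF v] x0(2)[OF z(1)] by simp
    also have "\<dots> < K * e\<^sup>2" using e by (simp add: K_def)
    finally show ?thesis using K e by (simp add: power2_less_imp_less)
  qed
  ultimately show thesis by (rule that)
qed

text \<open>
  Subgradients at points \<open>z\<close> near \<open>u\<close> satisfy \<open>\<omega>' z \<bullet> (z - u) \<ge> \<omega> z - \<omega> u \<ge> p \<bullet> (z - u)\<close>.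
  Letting \<open>z\<close> approach \<open>u\<close> tangentially to \<open>y - u\<close> and using continuity of \<open>\<omega>'\<close> shows
  that \<open>\<omega>' u\<close> is the largest subgradient in every feasible direction. The segment from \<open>u\<close>
  to \<open>y\<close> may leave the domain of \<open>\<omega>'\<close>, so \<open>z\<close> is taken at distance below \<open>t\<^sup>2\<close> from
  \<open>u + t (y - u)\<close>, which does not disturb the direction in the limit.
\<close>
lemma selection_dominates:
  fixes Y :: "'a::euclidean_space set"
  assumes Y: "compact Y" "convex Y" and dgf: "dgf Y nrm \<omega> \<omega>'"
    and u: "u \<in> Y" and p: "p \<in> subdiff Y \<omega> u" and y: "y \<in> Y"
  shows "p \<bullet> (y - u) \<le> \<omega>' u \<bullet> (y - u)"
proof -
  have d: "continuous_on Y \<omega>" "convex_on Y \<omega>" "continuous_on (subdiff_dom Y \<omega>) \<omega>'"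
    "\<And>y. y \<in> subdiff_dom Y \<omega> \<Longrightarrow> \<omega>' y \<in> subdiff Y \<omega> y"
    using dgf by (auto simp: dgf_def)
  have ud: "u \<in> subdiff_dom Y \<omega>" using u p by (auto simp: subdiff_dom_def)
  define t where "t n = inverse (real (Suc n))" for n
  have t: "0 < t n" "t n \<le> 1" for n by (auto simp: t_def field_simps)
  have t0: "t \<longlonglongrightarrow> 0" unfolding t_def by (rule LIMSEQ_inverse_real_of_nat)
  have "\<exists>z\<in>subdiff_dom Y \<omega>. norm (z - (u + t n *\<^sub>R (y - u))) < (t n)\<^sup>2" for n
  proof -
    have "(1 - t n) *\<^sub>R u + t n *\<^sub>R y \<in> Y" using t[of n] Y(2) u y by (simp add: convex_alt less_imp_le)
    then have "u + t n *\<^sub>R (y - u) \<in> Y" by (simp add: algebra_simps)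
    moreover have "0 < (t n)\<^sup>2" using t[of n] by simp
    ultimately obtain z where "z \<in> subdiff_dom Y \<omega>" "norm (z - (u + t n *\<^sub>R (y - u))) < (t n)\<^sup>2"
      by (rule subdiff_dom_dense[OF Y(1) d(2,1)])
    then show ?thesis by blast
  qed
  then have "\<forall>n. \<exists>z. z \<in> subdiff_dom Y \<omega> \<and> norm (z - (u + t n *\<^sub>R (y - u))) < (t n)\<^sup>2" by blast
  from choice[OF this] obtain z where z: "\<And>n. z n \<in> subdiff_dom Y \<omega>"
      "\<And>n. norm (z n - (u + t n *\<^sub>R (y - u))) < (t n)\<^sup>2" by blast
  define w where "w n = (z n - u) /\<^sub>R t n" for n
  have zw: "z n = u + t n *\<^sub>R w n" for n using t(1)[of n] by (simp add: w_def)
  have "norm (w n - (y - u)) \<le> t n" for n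
  proof -
    have "z n - (u + t n *\<^sub>R (y - u)) = t n *\<^sub>R (w n - (y - u))" by (simp add: zw algebra_simps)
    then have "t n * norm (w n - (y - u)) < t n * t n" using z(2)[of n] t(1)[of n] by (simp add: power2_eq_square)
    then show ?thesis using t(1)[of n] by simp
  qed
  then have "(\<lambda>n. w n - (y - u)) \<longlonglongrightarrow> 0"
    by (intro Lim_null_comparison[OF always_eventually t0]) auto
  then have w: "w \<longlonglongrightarrow> y - u" using Lim_null by blast
  have "z \<longlonglongrightarrow> u + 0 *\<^sub>R (y - u)" unfolding zw[abs_def] by (intro tendsto_intros t0 w)
  then have "z \<longlonglongrightarrow> u" by simp
  then have "(\<lambda>n. \<omega>' (z n)) \<longlonglongrightarrow> \<omega>' u"
    using d(3) ud z(1) by (auto simp: continuous_on_sequentially o_def)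
  then have lim: "(\<lambda>n. (\<omega>' (z n) - p) \<bullet> w n) \<longlonglongrightarrow> (\<omega>' u - p) \<bullet> (y - u)"
    by (intro tendsto_intros w)
  have "0 \<le> (\<omega>' (z n) - p) \<bullet> w n" for n
  proof -
    have zY: "z n \<in> Y" using z(1)[of n] by (simp add: subdiff_dom_def)
    have "\<omega> (z n) + \<omega>' (z n) \<bullet> (u - z n) \<le> \<omega> u" using d(4)[OF z(1)[of n]] u by (auto simp: subdiff_def)
    moreover have "\<omega> u + p \<bullet> (z n - u) \<le> \<omega> (z n)" using p zY by (auto simp: subdiff_def)
    ultimately have "0 \<le> (\<omega>' (z n) - p) \<bullet> (z n - u)" by (simp add: inner_diff_left inner_diff_right)
    then show ?thesis using t(1)[of n] by (simp add: w_def)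
  qed
  then have "0 \<le> (\<omega>' u - p) \<bullet> (y - u)" by (intro LIMSEQ_le_const[OF lim]) auto
  then show ?thesis by (simp add: inner_diff_left)
qed

text \<open>
  Strong convexity, measured along a linear functional \<open>G\<close> of dual norm at most \<open>L\<close>. The
  segment from \<open>u\<close> to \<open>d\<close> may leave the domain of \<open>\<omega>'\<close>, so instead of points on the
  segment, consider for \<open>0 \<le> t < a\<close> a minimizer \<open>x\<close> of \<open>\<phi> = \<omega> - \<omega>' u \<bullet> (\<cdot>)\<close> over the
  part of \<open>Y\<close> with \<open>G \<bullet> (u - x) \<ge> t\<close>. Such minimizers have subgradients. The multiplier of
  the constraint is the slope of the minimal value as a function of \<open>t\<close>, and monotonicity
  of \<open>\<omega>'\<close> between \<open>x\<close> and \<open>u\<close> forces this slope to be at least \<open>t / L\<^sup>2\<close>. Integrating over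
  \<open>0 \<le> t \<le> a\<close> by Riemann sums yields \<open>a\<^sup>2 / (2 L\<^sup>2)\<close>.
\<close>
lemma dgf_growth:
  fixes Y :: "'a::euclidean_space set"
  assumes Y: "compact Y" "convex Y" and nrm: "is_norm nrm" and dgf: "dgf Y nrm \<omega> \<omega>'"
    and u: "u \<in> subdiff_dom Y \<omega>" and d: "d \<in> Y"
    and G: "dual_norm nrm G \<le> L" and a: "0 < a" "a \<le> G \<bullet> (u - d)"
  shows "0 < L" and "\<omega> u + \<omega>' u \<bullet> (d - u) + a\<^sup>2 / (2 * L\<^sup>2) \<le> \<omega> d"
proof -
  have nrm0: "0 \<le> nrm x" for x using nrm by (auto simp: is_norm_def)
  have nsym: "nrm (x - y) = nrm (y - x)" for x y
  proof -
    have "nrm (x - y) = nrm ((-1) *\<^sub>R (y - x))" by simp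
    also have "\<dots> = \<bar>-1\<bar> * nrm (y - x)" using nrm unfolding is_norm_def by blast
    finally show ?thesis by simp
  qed
  have GL: "G \<bullet> (u - x) \<le> L * nrm (x - u)" for x
  proof -
    have "G \<bullet> (u - x) \<le> dual_norm nrm G * nrm (u - x)" by (rule dual_norm_ge[OF nrm])
    also have "\<dots> \<le> L * nrm (u - x)" using G nrm0 by (rule mult_right_mono)
    finally show ?thesis by (simp add: nsym)
  qed
  have "0 < L * nrm (d - u)" using a GL[of d] by linarith
  with nrm0[of "d - u"] show L: "0 < L" by (simp add: zero_less_mult_iff)
  have dg: "continuous_on Y \<omega>" "convex_on Y \<omega>"
    "\<And>y. y \<in> subdiff_dom Y \<omega> \<Longrightarrow> \<omega>' y \<in> subdiff Y \<omega> y"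
    "\<And>y y'. y \<in> subdiff_dom Y \<omega> \<Longrightarrow> y' \<in> subdiff_dom Y \<omega> \<Longrightarrow>
      (nrm (y - y'))\<^sup>2 \<le> (\<omega>' y - \<omega>' y') \<bullet> (y - y')"
    using dgf by (auto simp: dgf_def)
  have uY: "u \<in> Y" using u by (simp add: subdiff_dom_def)
  define \<phi> where "\<phi> x = \<omega> x - \<omega>' u \<bullet> x" for x
  have "convex_on Y (\<lambda>x. \<omega> x + - (\<omega>' u \<bullet> x))"
    using Y(2) by (intro convex_on_add dg(2)) (auto simp: convex_on_def inner_add_right algebra_simps)
  then have c\<phi>: "convex_on Y \<phi>" by (simp add: \<phi>_def[abs_def])
  have cont\<phi>: "continuous_on Y \<phi>" unfolding \<phi>_def[abs_def] by (intro continuous_intros dg)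
  have umin: "\<phi> u \<le> \<phi> x" if "x \<in> Y" for x
    using dg(3)[OF u] that by (auto simp: subdiff_def \<phi>_def inner_diff_right)
  have conch: "concave_on Y (\<lambda>x. G \<bullet> (u - x) - t)" for t
    using Y(2) unfolding concave_on_iff
  proof (intro conjI ballI allI impI)
    fix x y and v w :: real assume "0 \<le> v" "0 \<le> w" and vw: "v + w = 1"
    then have v: "v = 1 - w" by simp
    show "v * (G \<bullet> (u - x) - t) + w * (G \<bullet> (u - y) - t) \<le> G \<bullet> (u - (v *\<^sub>R x + w *\<^sub>R y)) - t"
      unfolding v by (simp add: inner_diff_right inner_add_right algebra_simps)
  qed
  have slice: "\<exists>x\<in>Y. t \<le> G \<bullet> (u - x) \<and> (\<exists>\<mu>\<ge>t / L\<^sup>2. 0 \<le> \<mu> \<and>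
      (\<forall>y\<in>Y. \<phi> x + \<mu> * (G \<bullet> (u - y) - t) \<le> \<phi> y))" if t: "0 \<le> t" "t < a" for t
  proof -
    define S where "S = Y \<inter> {x. t \<le> G \<bullet> (u - x)}"
    have "compact S" unfolding S_def
      by (intro compact_Int_closed Y closed_Collect_le continuous_intros)
    moreover have "S \<noteq> {}" using d a t by (auto simp: S_def)
    moreover have "continuous_on S \<phi>" using cont\<phi> by (rule continuous_on_subset) (auto simp: S_def)
    ultimately obtain x where x: "x \<in> S" "\<And>y. y \<in> S \<Longrightarrow> \<phi> x \<le> \<phi> y"
      using continuous_attains_inf by metis
    have xY: "x \<in> Y" "t \<le> G \<bullet> (u - x)" using x by (auto simp: S_def)
    have "\<exists>\<mu>\<ge>0. \<mu> * (G \<bullet> (u - x) - t) = 0 \<and> (\<forall>y\<in>Y. \<phi> x \<le> \<phi> y - \<mu> * (G \<bullet> (u - y) - t))"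
      by (rule lagrange_multiplier_single[OF c\<phi> conch])
        (use x d a t in \<open>auto simp: S_def intro!: bexI[of _ d]\<close>)
    then obtain \<mu> where \<mu>: "0 \<le> \<mu>" "\<mu> * (G \<bullet> (u - x) - t) = 0"
      "\<And>y. y \<in> Y \<Longrightarrow> \<phi> x \<le> \<phi> y - \<mu> * (G \<bullet> (u - y) - t)" by blast
    \<comment> \<open>So \<open>x\<close> lies in the domain of the selection, and \<open>\<omega>' x\<close> can be compared with \<open>\<omega>' u\<close>.\<close>
    have p: "\<omega>' u - \<mu> *\<^sub>R G \<in> subdiff Y \<omega> x"
      using \<mu>(2,3) by (auto simp: subdiff_def \<phi>_def algebra_simps inner_diff_right inner_add_right)
    have xd: "x \<in> subdiff_dom Y \<omega>" using p xY by (auto simp: subdiff_dom_def)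
    have "(\<omega>' u - \<mu> *\<^sub>R G) \<bullet> (u - x) \<le> \<omega>' x \<bullet> (u - x)"
      by (rule selection_dominates[OF Y dgf xY(1) p uY])
    then have "(\<omega>' x - \<omega>' u) \<bullet> (x - u) \<le> \<mu> * (G \<bullet> (u - x))"
      by (simp add: inner_diff_left inner_diff_right algebra_simps)
    also have "\<dots> = \<mu> * t" using \<mu>(2) by (simp add: algebra_simps)
    finally have "(nrm (x - u))\<^sup>2 \<le> \<mu> * t" using dg(4)[OF xd u] by linarith
    moreover have "t / L \<le> nrm (x - u)" using xY(2) GL[of x] L by (simp add: field_simps)
    then have "(t / L)\<^sup>2 \<le> (nrm (x - u))\<^sup>2" using t L by (intro power_mono) auto
    ultimately have "t * (t / L\<^sup>2) \<le> t * \<mu>" by (simp add: power2_eq_square algebra_simps)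
    then have "t / L\<^sup>2 \<le> \<mu>" using t \<mu>(1) by (cases "t = 0") (auto simp: mult_le_cancel_left simp del: times_divide_eq_right)
    then show ?thesis using xY \<mu> by (auto simp: algebra_simps intro!: bexI[of _ x] exI[of _ \<mu>])
  qed
  define D where "D = a\<^sup>2 / L\<^sup>2"
  have riemann: "\<phi> u + D * (real (n - 1) / (2 * real n)) \<le> \<phi> d" if n: "1 \<le> n" for n
  proof -
    define h where "h = a / real n"
    have h: "0 < h" "real n * h = a" using n a by (auto simp: h_def)
    have step: "\<forall>x\<in>Y. real k * h \<le> G \<bullet> (u - x) \<longrightarrow> \<phi> u + h\<^sup>2 / L\<^sup>2 * (\<Sum>i<k. real i) \<le> \<phi> x"
      if "k \<le> n" for k
      using that
    proof (induction k)
      case 0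
      then show ?case using umin by simp
    next
      case (Suc k)
      have "real k * h < real n * h" using Suc.prems h by (intro mult_strict_right_mono) auto
      then have kh: "0 \<le> real k * h" "real k * h < a" using h by auto
      from slice[OF this] obtain x \<mu> where x: "x \<in> Y" "real k * h \<le> G \<bullet> (u - x)"
        "real k * h / L\<^sup>2 \<le> \<mu>" "0 \<le> \<mu>"
        "\<And>y. y \<in> Y \<Longrightarrow> \<phi> x + \<mu> * (G \<bullet> (u - y) - real k * h) \<le> \<phi> y" by blast
      have IH: "\<phi> u + h\<^sup>2 / L\<^sup>2 * (\<Sum>i<k. real i) \<le> \<phi> x" using Suc x by auto
      show ?case
      proof (intro ballI impI)
        fix y assume y: "y \<in> Y" "real (Suc k) * h \<le> G \<bullet> (u - y)"
        have "real k * h / L\<^sup>2 * h \<le> \<mu> * (G \<bullet> (u - y) - real k * h)"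
          using x(3,4) y(2) h by (intro mult_mono) (auto simp: algebra_simps)
        with IH x(5)[OF y(1)]
        have "\<phi> u + h\<^sup>2 / L\<^sup>2 * (\<Sum>i<k. real i) + real k * h / L\<^sup>2 * h \<le> \<phi> y" by linarith
        then show "\<phi> u + h\<^sup>2 / L\<^sup>2 * (\<Sum>i<Suc k. real i) \<le> \<phi> y"
          by (simp add: distrib_left power2_eq_square add_divide_distrib ac_simps)
      qed
    qed
    have "\<phi> u + h\<^sup>2 / L\<^sup>2 * (\<Sum>i<n. real i) \<le> \<phi> d" using step[of n] d a h by auto
    moreover have "h\<^sup>2 / L\<^sup>2 * (\<Sum>i<n. real i) = D * (real (n - 1) / (2 * real n))"
    proof -
      have sums: "(\<Sum>i<n. real i) = real n * real (n - 1) / 2"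
        using n by (induction n rule: dec_induct) (auto simp: field_simps of_nat_diff)
      show ?thesis unfolding sums h_def D_def using n by (simp add: power2_eq_square ac_simps)
    qed
    ultimately show ?thesis by simp
  qed
  have "(\<lambda>n. 1 / 2 - inverse (real n) / 2) \<longlonglongrightarrow> 1 / 2 - 0 / 2"
    by (intro tendsto_intros lim_inverse_n) simp
  moreover have "\<forall>\<^sub>F n in sequentially. 1 / 2 - inverse (real n) / 2 = real (n - 1) / (2 * real n)"
    using eventually_ge_at_top[of 1] by eventually_elim (auto simp: field_simps of_nat_diff)
  ultimately have half: "(\<lambda>n. real (n - 1) / (2 * real n)) \<longlonglongrightarrow> 1 / 2"
    using tendsto_cong by fastforce
  have lim: "(\<lambda>n. \<phi> u + D * (real (n - 1) / (2 * real n))) \<longlonglongrightarrow> \<phi> u + D * (1 / 2)"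
    by (intro tendsto_add tendsto_mult tendsto_const half)
  have "\<phi> u + D * (1 / 2) \<le> \<phi> d" by (rule LIMSEQ_le_const2[OF lim]) (use riemann in blast)
  then show "\<omega> u + \<omega>' u \<bullet> (d - u) + a\<^sup>2 / (2 * L\<^sup>2) \<le> \<omega> d"
    by (simp add: \<phi>_def D_def inner_diff_right)
qed

section \<open>Stored functions and their weights\<close>

lemma comb_fun_grad: "comb_fun P c y = comb_fun P c z + comb_grad P c \<bullet> (y - z)"
proof -
  have "comb_grad P c \<bullet> (y - z) = (\<Sum>i<length P. - (c i * (snd (P ! i) \<bullet> (y - z))))"
    by (simp add: comb_grad_def inner_sum_left sum_negf)
  then show ?thesis unfolding comb_fun_def
    by (simp add: sum.distrib[symmetric] inner_diff_right algebra_simps)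
qed

lemma comb_fun_affine:
  assumes "v + w = 1"
  shows "comb_fun P c (v *\<^sub>R x + w *\<^sub>R y) = v * comb_fun P c x + w * comb_fun P c y"
proof -
  have v: "v = 1 - w" using assms by simp
  have "comb_fun P c (v *\<^sub>R x + w *\<^sub>R y) = comb_fun P c x + comb_grad P c \<bullet> (w *\<^sub>R (y - x))"
    unfolding v by (subst comb_fun_grad[of P c _ x]) (simp add: algebra_simps)
  also have "comb_grad P c \<bullet> (w *\<^sub>R (y - x)) = w * (comb_fun P c y - comb_fun P c x)"
    by (simp add: comb_fun_grad[of P c y x])
  finally show ?thesis unfolding v by (simp add: algebra_simps)
qed

lemma continuous_on_comb_fun [continuous_intros]: "continuous_on S (comb_fun P c)"
  unfolding comb_fun_def[abs_def] by (intro continuous_intros)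

lemma comb_fun_sum:
  "comb_fun P (\<lambda>i. \<Sum>j\<in>J. a j * H j i) z = (\<Sum>j\<in>J. a j * comb_fun P (H j) z)"
  unfolding comb_fun_def sum_distrib_left sum_distrib_right
  by (subst sum.swap) (simp add: mult.assoc)

lemma comb_fun_append:
  assumes "c (length P) = 0"
  shows "comb_fun (P @ [x]) c = comb_fun P c"
  by (rule ext) (use assms in \<open>simp add: comb_fun_def nth_append\<close>)

lemma comb_fun_unit_last:
  "comb_fun (P @ [(u, v)]) (unit_weight (length P)) z = v \<bullet> (u - z)"
  by (simp add: comb_fun_def unit_weight_def nth_append)

lemma is_weights_unit: "k < n \<Longrightarrow> is_weights n (unit_weight k)"
  by (auto simp: is_weights_def unit_weight_def)

lemma is_weights_Suc: "is_weights n c \<Longrightarrow> is_weights (Suc n) c"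
  by (auto simp: is_weights_def)

lemma is_weights_one: "is_weights 1 c \<Longrightarrow> c = unit_weight 0"
  by (rule ext) (auto simp: is_weights_def unit_weight_def)

lemma is_weights_convex_comb:
  assumes "\<And>j. j \<in> J \<Longrightarrow> is_weights n (H j)" "\<And>j. j \<in> J \<Longrightarrow> 0 \<le> a j" "sum a J = 1"
  shows "is_weights n (\<lambda>i. \<Sum>j\<in>J. a j * H j i)"
proof -
  have "(\<Sum>i<n. \<Sum>j\<in>J. a j * H j i) = (\<Sum>j\<in>J. a j * (\<Sum>i<n. H j i))"
    unfolding sum_distrib_left by (rule sum.swap)
  also have "\<dots> = 1" using assms by (simp add: is_weights_def)
  finally show ?thesis using assms
    by (auto simp: is_weights_def intro!: sum_nonneg sum.neutral)
qed

lemma concave_on_comb_fun_minus: "convex S \<Longrightarrow> concave_on S (\<lambda>y. comb_fun P c y - l)"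
proof -
  assume S: "convex S"
  show ?thesis unfolding concave_on_iff
  proof (intro conjI S ballI allI impI)
    fix x y and v w :: real assume "0 \<le> v" "0 \<le> w" and vw: "v + w = 1"
    then have "v * l + w * l = l" by (simp flip: distrib_right)
    then show "v * (comb_fun P c x - l) + w * (comb_fun P c y - l) \<le> comb_fun P c (v *\<^sub>R x + w *\<^sub>R y) - l"
      by (simp add: comb_fun_affine[OF vw] right_diff_distrib)
  qed
qed

lemma arg_min_on_attained:
  assumes "x \<in> S" "\<And>y. y \<in> S \<Longrightarrow> f x \<le> (f y :: real)"
  shows "arg_min_on f S \<in> S" "\<And>y. y \<in> S \<Longrightarrow> f (arg_min_on f S) \<le> f y"
proof -
  have "is_arg_min f (\<lambda>x. x \<in> S) x" using assms by (force simp: is_arg_min_linorder)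
  then have "is_arg_min f (\<lambda>x. x \<in> S) (arg_min_on f S)"
    unfolding arg_min_on_def arg_min_def by (rule someI)
  then show "arg_min_on f S \<in> S" "\<And>y. y \<in> S \<Longrightarrow> f (arg_min_on f S) \<le> f y"
    by (auto simp: is_arg_min_linorder)
qed

lemma arg_min_on_compact:
  fixes f :: "'b::topological_space \<Rightarrow> real"
  assumes "compact S" "S \<noteq> {}" "continuous_on S f"
  shows "arg_min_on f S \<in> S" "\<And>y. y \<in> S \<Longrightarrow> f (arg_min_on f S) \<le> f y"
  using continuous_attains_inf[OF assms] arg_min_on_attained[of _ S f] by blast+

lemma residual_attained:
  assumes "compact Y" "Y \<noteq> {}"
  obtains y where "y \<in> Y" "residual Y P c = comb_fun P c y" "\<And>z. z \<in> Y \<Longrightarrow> comb_fun P c z \<le> residual Y P c"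
proof -
  obtain y where y: "y \<in> Y" "\<And>z. z \<in> Y \<Longrightarrow> comb_fun P c z \<le> comb_fun P c y"
    using continuous_attains_sup[OF assms continuous_on_comb_fun] by blast
  have "residual Y P c = comb_fun P c y"
    unfolding residual_def by (rule cSup_eq_maximum) (use y in auto)
  with y that show thesis by simp
qed

lemma continuous_on_MIN:
  fixes f :: "'j \<Rightarrow> 'b::topological_space \<Rightarrow> real"
  assumes "finite J" "J \<noteq> {}" "\<And>j. j \<in> J \<Longrightarrow> continuous_on S (f j)"
  shows "continuous_on S (\<lambda>y. MIN j\<in>J. f j y)"
  using assms
proof (induction J rule: finite_ne_induct)
  case (insert k J)
  have "(\<lambda>y. MIN j\<in>insert k J. f j y) = (\<lambda>y. min (f k y) (MIN j\<in>J. f j y))"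
    using insert.hyps by simp
  with insert show ?case by (simp add: continuous_on_min)
qed simp

text \<open>
  The minimum is expressed through the levels \<open>r\<close> that all functions reach at once. In this form
  \<open>(y, opt_value)\<close> solves a problem with linear objective in \<open>Y \<times> \<real>\<close>.
\<close>
lemma opt_value_attained:
  assumes "compact Y" "Y \<noteq> {}" "1 \<le> n"
  obtains y where "y \<in> Y" "\<And>j. j \<in> {1..n} \<Longrightarrow> opt_value Y n P H \<le> comb_fun P (H j) y"
    "\<And>z r. z \<in> Y \<Longrightarrow> (\<And>j. j \<in> {1..n} \<Longrightarrow> r \<le> comb_fun P (H j) z) \<Longrightarrow> r \<le> opt_value Y n P H"
proof -
  let ?M = "\<lambda>y. MIN j\<in>{1..n}. comb_fun P (H j) y"
  have J: "finite {1..n}" "{1..n} \<noteq> {}" using assms by auto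
  obtain y where y: "y \<in> Y" "\<And>z. z \<in> Y \<Longrightarrow> ?M z \<le> ?M y"
    using continuous_attains_sup[OF assms(1,2) continuous_on_MIN[OF J, of Y "\<lambda>j. comb_fun P (H j)"]]
      continuous_on_comb_fun by blast
  have eq: "opt_value Y n P H = ?M y"
    unfolding opt_value_def by (rule cSup_eq_maximum) (use y in auto)
  show thesis
  proof (rule that[OF y(1)])
    show "opt_value Y n P H \<le> comb_fun P (H j) y" if "j \<in> {1..n}" for j
      unfolding eq using that J by (intro Min_le) auto
    show "r \<le> opt_value Y n P H" if "z \<in> Y" "\<And>j. j \<in> {1..n} \<Longrightarrow> r \<le> comb_fun P (H j) z" for z r
    proof -
      have "r \<le> ?M z" using that J by (subst Min_ge_iff) auto
      with y(2)[OF that(1)] show ?thesis unfolding eq by linarith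
    qed
  qed
qed

lemma opt_value_le_residual:
  assumes "compact Y" "Y \<noteq> {}" "j \<in> {1..n}"
  shows "opt_value Y n P H \<le> residual Y P (H j)"
proof -
  have "1 \<le> n" using assms by simp
  from opt_value_attained[OF assms(1,2) this] obtain y where
    y: "y \<in> Y" "\<And>j. j \<in> {1..n} \<Longrightarrow> opt_value Y n P H \<le> comb_fun P (H j) y" by metis
  show ?thesis using residual_attained[OF assms(1,2), of P "H j"] y(1) y(2)[OF assms(3)]
    by (metis order_trans)
qed

section \<open>Solvability of the auxiliary problems\<close>

text \<open>
  Max-min duality: maximize \<open>r\<close> subject to \<open>h\<^sub>j y \<ge> r\<close> over \<open>(y, r) \<in> Y \<times> \<real>\<close>. Decreasing \<open>r\<close>
  gives a Slater point for free. The Lagrangian is affine in the unrestricted variable \<open>r\<close>,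
  so its coefficient has to vanish, which says that the multipliers sum to one.
\<close>
lemma opt_comb_exists:
  fixes Y :: "'a::euclidean_space set"
  assumes Y: "compact Y" "convex Y" "Y \<noteq> {}" and n: "1 \<le> n"
  shows "\<exists>c. opt_comb Y n P H c"
proof -
  let ?J = "{1..n}" and ?o = "opt_value Y n P H"
  obtain y where y: "y \<in> Y" "\<And>j. j \<in> ?J \<Longrightarrow> ?o \<le> comb_fun P (H j) y"
    "\<And>z r. z \<in> Y \<Longrightarrow> (\<And>j. j \<in> ?J \<Longrightarrow> r \<le> comb_fun P (H j) z) \<Longrightarrow> r \<le> ?o"
    using opt_value_attained[OF Y(1,3) n, where P = P and H = H] by blast
  define S where "S = Y \<times> (UNIV :: real set)"
  define h where "h j x = comb_fun P (H j) (fst x) - snd x" for j and x :: "'a \<times> real"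
  have cS: "convex S" unfolding S_def using Y(2) by (intro convex_Times) auto
  have conv: "convex_on S (\<lambda>x. - snd x)"
    using cS by (auto simp: convex_on_def)
  have conc: "concave_on S (h j)" for j
    unfolding concave_on_iff
  proof (intro conjI cS ballI allI impI)
    fix x y :: "'a \<times> real" and v w :: real assume "0 \<le> v" "0 \<le> w" and vw: "v + w = 1"
    show "v * h j x + w * h j y \<le> h j (v *\<^sub>R x + w *\<^sub>R y)"
      by (simp add: h_def comb_fun_affine[OF vw] right_diff_distrib)
  qed
  have "\<exists>\<mu>. (\<forall>j\<in>?J. 0 \<le> \<mu> j \<and> \<mu> j * h j (y, ?o) = 0) \<and>
     (\<forall>x\<in>S. - snd (y, ?o) \<le> - snd x - (\<Sum>j\<in>?J. \<mu> j * h j x))"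
  proof (rule lagrange_multipliers[OF _ conv conc])
    show "finite ?J" by simp
    show "(y, ?o) \<in> S" using y by (simp add: S_def)
    show "0 \<le> h j (y, ?o)" if "j \<in> ?J" for j using y(2)[OF that] by (simp add: h_def)
    show "\<exists>z\<in>S. \<forall>j\<in>?J. 0 < h j z"
    proof
      show "(y, ?o - 1) \<in> S" using y(1) by (simp add: S_def)
      show "\<forall>j\<in>?J. 0 < h j (y, ?o - 1)" using y(2) by (fastforce simp: h_def)
    qed
    show "- snd (y, ?o) \<le> - snd x" if "x \<in> S" "\<And>j. j \<in> ?J \<Longrightarrow> 0 \<le> h j x" for x
      using y(3)[of "fst x" "snd x"] that by (auto simp: S_def h_def)
  qed
  then obtain \<mu> where \<mu>: "\<And>j. j \<in> ?J \<Longrightarrow> 0 \<le> \<mu> j \<and> \<mu> j * h j (y, ?o) = 0"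
    and opt: "\<And>x. x \<in> S \<Longrightarrow> snd x + (\<Sum>j\<in>?J. \<mu> j * h j x) \<le> ?o" by fastforce
  define c where "c = (\<lambda>i. \<Sum>j=1..n. \<mu> j * H j i)"
  have val: "(\<Sum>j\<in>?J. \<mu> j * h j (z, r)) = comb_fun P c z - r * sum \<mu> ?J" for z r
    by (simp add: h_def c_def comb_fun_sum right_diff_distrib sum_subtractf sum_distrib_left mult.commute)
  have z0: "comb_fun P c y - ?o * sum \<mu> ?J = 0"
    unfolding val[symmetric] using \<mu> by (intro sum.neutral) auto
  have le: "r + (comb_fun P c z - r * sum \<mu> ?J) \<le> ?o" if "z \<in> Y" for z r
    using opt[of "(z, r)"] that unfolding val S_def by simp
  \<comment> \<open>Moving \<open>r\<close> up and down by one shows that its coefficient \<open>1 - sum \<mu> ?J\<close> is zero.\<close>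
  have one: "sum \<mu> ?J = 1"
    using le[OF y(1), of "?o + 1"] le[OF y(1), of "?o - 1"] z0 by (simp add: algebra_simps)
  have "residual Y P c = ?o"
    unfolding residual_def
  proof (rule cSup_eq_maximum)
    show "?o \<in> comb_fun P c ` Y" using z0 one y(1) by (auto simp: image_iff intro!: bexI[of _ y])
    show "x \<le> ?o" if "x \<in> comb_fun P c ` Y" for x using that le[of _ 0] by auto
  qed
  with \<mu> one show ?thesis unfolding opt_comb_def c_def by blast
qed

lemma opt_comb_is_weights:
  assumes "opt_comb Y n P H c" "\<And>j. j \<in> {1..n} \<Longrightarrow> is_weights k (H j)"
  shows "is_weights k c"
  using assms is_weights_convex_comb[of "{1..n}" k H] unfolding opt_comb_def by auto

lemma level_set_arg_min:
  fixes \<omega> :: "'a::euclidean_space \<Rightarrow> real"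
  assumes Y: "compact Y" and cont: "continuous_on Y \<omega>" and ne: "level_set Y n P H l \<noteq> {}"
  defines "u \<equiv> arg_min_on \<omega> (level_set Y n P H l)"
  shows "u \<in> level_set Y n P H l" "\<And>y. y \<in> level_set Y n P H l \<Longrightarrow> \<omega> u \<le> \<omega> y"
proof -
  have eq: "level_set Y n P H l = Y \<inter> (\<Inter>j\<in>{1..n}. {y. l \<le> comb_fun P (H j) y})"
    by (auto simp: level_set_def)
  have c: "compact (level_set Y n P H l)" unfolding eq
    by (intro compact_Int_closed Y closed_INT ballI closed_Collect_le continuous_intros)
  have k: "continuous_on (level_set Y n P H l) \<omega>"
    using cont by (rule continuous_on_subset) (auto simp: level_set_def)
  show "u \<in> level_set Y n P H l" "\<And>y. y \<in> level_set Y n P H l \<Longrightarrow> \<omega> u \<le> \<omega> y"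
    unfolding u_def by (fact arg_min_on_compact[OF c ne k])+
qed

text \<open>
  The multipliers turn the minimizer over the level set into a minimizer of a Lagrangian over
  all of \<open>Y\<close>, so the combined gradient is a subgradient of \<open>\<omega>\<close> there. That \<open>\<omega>'\<close> itself
  satisfies the optimality condition is \<open>selection_dominates\<close>.
\<close>
lemma kkt_exists:
  fixes Y :: "'a::euclidean_space set"
  assumes Y: "compact Y" "convex Y" and dgf: "dgf Y nrm \<omega> \<omega>'"
    and slater: "z \<in> Y" "\<And>j. j \<in> {1..n} \<Longrightarrow> l < comb_fun P (H j) z"
  defines "u \<equiv> arg_min_on \<omega> (level_set Y n P H l)"
  shows "u \<in> subdiff_dom Y \<omega>" and "\<exists>\<mu>. kkt_mult Y \<omega>' n P H l u \<mu>"
proof -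
  let ?J = "{1..n}"
  have d: "continuous_on Y \<omega>" "convex_on Y \<omega>" using dgf by (auto simp: dgf_def)
  have "z \<in> level_set Y n P H l" using slater by (auto simp: level_set_def less_imp_le)
  then have ne: "level_set Y n P H l \<noteq> {}" by blast
  note u = level_set_arg_min[OF Y(1) d(1) ne, folded u_def]
  have uY: "u \<in> Y" "\<And>j. j \<in> ?J \<Longrightarrow> l \<le> comb_fun P (H j) u" using u(1) by (auto simp: level_set_def)
  have "\<exists>\<mu>. (\<forall>j\<in>?J. 0 \<le> \<mu> j \<and> \<mu> j * (comb_fun P (H j) u - l) = 0) \<and>
     (\<forall>y\<in>Y. \<omega> u \<le> \<omega> y - (\<Sum>j\<in>?J. \<mu> j * (comb_fun P (H j) y - l)))"
    by (rule lagrange_multipliers[OF _ d(2) concave_on_comb_fun_minus[OF Y(2)]])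
      (use uY slater in \<open>auto intro!: u(2) bexI[of _ z] simp: level_set_def\<close>)
  then obtain \<mu> where \<mu>: "\<And>j. j \<in> ?J \<Longrightarrow> 0 \<le> \<mu> j" "\<And>j. j \<in> ?J \<Longrightarrow> \<mu> j * (comb_fun P (H j) u - l) = 0"
    "\<And>y. y \<in> Y \<Longrightarrow> \<omega> u \<le> \<omega> y - (\<Sum>j\<in>?J. \<mu> j * (comb_fun P (H j) y - l))" by blast
  let ?p = "\<Sum>j=1..n. \<mu> j *\<^sub>R comb_grad P (H j)"
  have "?p \<bullet> (y - u) = (\<Sum>j\<in>?J. \<mu> j * (comb_fun P (H j) y - l))" for y
    unfolding inner_sum_left
  proof (rule sum.cong[OF refl])
    fix j assume "j \<in> ?J"
    have "(\<mu> j *\<^sub>R comb_grad P (H j)) \<bullet> (y - u) = \<mu> j * (comb_fun P (H j) y - comb_fun P (H j) u)"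
      using comb_fun_grad[of P "H j" y u] by simp
    then show "(\<mu> j *\<^sub>R comb_grad P (H j)) \<bullet> (y - u) = \<mu> j * (comb_fun P (H j) y - l)"
      using \<mu>(2)[OF \<open>j \<in> ?J\<close>] by auto
  qed
  with \<mu>(3) have p: "?p \<in> subdiff Y \<omega> u" by (force simp: subdiff_def)
  then show "u \<in> subdiff_dom Y \<omega>" using uY by (auto simp: subdiff_dom_def)
  have "kkt_mult Y \<omega>' n P H l u \<mu>"
    unfolding kkt_mult_def using \<mu>(1,2) selection_dominates[OF Y dgf uY(1) p]
    by (auto simp: inner_diff_left)
  then show "\<exists>\<mu>. kkt_mult Y \<omega>' n P H l u \<mu>" by blast
qed

lemma bundle_update_exists: "\<exists>H'. bundle_update m \<mu> H H'"
proof -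
  let ?M = "\<Sum>j=1..m+1. \<mu> j"
  let ?H' = "if ?M > 0 then H(1 := (\<lambda>i. (\<Sum>j=1..m+1. \<mu> j * H j i) / ?M)) else H"
  have "bundle_update m \<mu> H ?H'"
    unfolding bundle_update_def Let_def
    by (auto intro!: exI[of _ "\<lambda>j. j"])
  then show ?thesis by blast
qed

lemma bundle_update_is_weights:
  assumes "bundle_update m \<mu> H H'" "\<And>j. j \<in> {1..m+1} \<Longrightarrow> 0 \<le> \<mu> j"
    "\<And>j. j \<in> {1..m+1} \<Longrightarrow> is_weights k (H j)" "j \<in> {1..m}"
  shows "is_weights k (H' j)"
proof -
  define M where "M = (\<Sum>j=1..m+1. \<mu> j)"
  show ?thesis
  proof (cases "M > 0")
    case True
    then obtain \<pi> where H': "H' 1 = (\<lambda>i. (\<Sum>j=1..m+1. \<mu> j * H j i) / M)"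
      "\<pi> ` {2..m} \<subseteq> {1..m+1}" "\<forall>j\<in>{2..m}. H' j = H (\<pi> j)"
      using assms(1) unfolding bundle_update_def Let_def M_def[symmetric] by auto
    show ?thesis
    proof (cases "j = 1")
      case True
      have "is_weights k (\<lambda>i. \<Sum>j=1..m+1. (\<mu> j / M) * H j i)"
      proof (rule is_weights_convex_comb)
        show "(\<Sum>j=1..m+1. \<mu> j / M) = 1"
          using \<open>M > 0\<close> by (simp only: sum_divide_distrib[symmetric] M_def[symmetric]) simp
      qed (use assms \<open>M > 0\<close> in auto)
      then show ?thesis unfolding True H'(1) by (simp only: sum_divide_distrib times_divide_eq_left)
    next
      case False
      then have "j \<in> {2..m}" using assms(4) by auto
      then have "\<pi> j \<in> {1..m+1}" "H' j = H (\<pi> j)" using H'(2,3) by blast+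
      with assms(3) show ?thesis by simp
    qed
  next
    case False
    then obtain \<pi> where H': "\<pi> ` {1..m} \<subseteq> {1..m+1}" "\<forall>j\<in>{1..m}. H' j = H (\<pi> j)"
      using assms(1) unfolding bundle_update_def Let_def M_def[symmetric] by auto
    then have "\<pi> j \<in> {1..m+1}" "H' j = H (\<pi> j)" using assms(4) by blast+
    with assms(3) show ?thesis by simp
  qed
qed

text \<open>
  The reason for aggregating: where the aggregate is at least \<open>l\<close>, the weighted sum of the old
  functions is at least its value at \<open>u\<close>, by complementary slackness. The half-space of the
  single aggregate thus retains the optimality of \<open>u\<close>, whichever other functions are discarded.
  If all multipliers vanish, \<open>u\<close> is optimal over \<open>Y\<close>.
\<close>
lemma bundle_update_variational:
  assumes m: "1 \<le> m" and b: "bundle_update m \<mu> H H'" and kkt: "kkt_mult Y \<omega>' (m + 1) P H l u \<mu>"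
    and y: "y \<in> Y" "\<And>j. j \<in> {1..m} \<Longrightarrow> l \<le> comb_fun P (H' j) y"
  shows "0 \<le> \<omega>' u \<bullet> (y - u)"
proof -
  let ?J = "{1..m+1}"
  define M where "M = (\<Sum>j\<in>?J. \<mu> j)"
  have \<mu>: "\<And>j. j \<in> ?J \<Longrightarrow> 0 \<le> \<mu> j" "\<And>j. j \<in> ?J \<Longrightarrow> \<mu> j * (comb_fun P (H j) u - l) = 0"
    and vi: "0 \<le> (\<omega>' u - (\<Sum>j\<in>?J. \<mu> j *\<^sub>R comb_grad P (H j))) \<bullet> (y - u)"
    using kkt y(1) by (auto simp: kkt_mult_def)
  have eq: "(\<Sum>j\<in>?J. \<mu> j *\<^sub>R comb_grad P (H j)) \<bullet> (y - u) = (\<Sum>j\<in>?J. \<mu> j * comb_fun P (H j) y) - l * M"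
    unfolding inner_sum_left M_def sum_distrib_left sum_subtractf[symmetric]
  proof (rule sum.cong[OF refl])
    fix j assume "j \<in> ?J"
    have "(\<mu> j *\<^sub>R comb_grad P (H j)) \<bullet> (y - u) = \<mu> j * (comb_fun P (H j) y - comb_fun P (H j) u)"
      using comb_fun_grad[of P "H j" y u] by simp
    then show "(\<mu> j *\<^sub>R comb_grad P (H j)) \<bullet> (y - u) = \<mu> j * comb_fun P (H j) y - l * \<mu> j"
      using \<mu>(2)[OF \<open>j \<in> ?J\<close>] by (auto simp: algebra_simps)
  qed
  have "0 \<le> (\<Sum>j\<in>?J. \<mu> j * comb_fun P (H j) y) - l * M"
  proof (cases "M > 0")
    case True
    then have H1: "H' 1 = (\<lambda>i. (\<Sum>j\<in>?J. \<mu> j * H j i) / M)"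
      using b unfolding bundle_update_def Let_def M_def[symmetric] by auto
    have "H' 1 = (\<lambda>i. \<Sum>j\<in>?J. (\<mu> j / M) * H j i)" unfolding H1 by (simp only: sum_divide_distrib times_divide_eq_left)
    then have "comb_fun P (H' 1) y = (\<Sum>j\<in>?J. (\<mu> j / M) * comb_fun P (H j) y)"
      by (simp only: comb_fun_sum)
    also have "\<dots> = (\<Sum>j\<in>?J. \<mu> j * comb_fun P (H j) y) / M"
      by (simp only: sum_divide_distrib times_divide_eq_left)
    finally show ?thesis using y(2)[of 1] m True by (simp add: pos_le_divide_eq)
  next
    case False
    have "0 \<le> M" unfolding M_def using \<mu>(1) by (rule sum_nonneg)
    with False have M0: "M = 0" by simp
    have "\<mu> j = 0" if "j \<in> ?J" for j
      using sum_nonneg_eq_0_iff[of ?J \<mu>] \<mu>(1) M0 that unfolding M_def by blast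
    then show ?thesis using M0 by simp
  qed
  with vi eq show ?thesis by (simp add: inner_diff_left)
qed

section \<open>The invariant of the algorithm\<close>

locale nerml =
  fixes Y :: "'a::euclidean_space set" and nrm :: "'a \<Rightarrow> real" and \<omega> :: "'a \<Rightarrow> real"
    and \<omega>' g :: "'a \<Rightarrow> 'a" and L \<epsilon> \<gamma> \<theta> :: real and m :: nat
  assumes Y: "Y \<noteq> {}" "convex Y" "compact Y" and nrm: "is_norm nrm"
    and dgf: "dgf Y nrm \<omega> \<omega>'" and g_bound: "\<forall>y\<in>Y. dual_norm nrm (g y) \<le> L"
    and \<epsilon>: "0 < \<epsilon>" and \<gamma>: "0 < \<gamma>" "\<gamma> < 1" and \<theta>: "0 < \<theta>" "\<theta> < 1" and m: "1 \<le> m"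
begin

abbreviation trans where "trans \<equiv> nerml_trans Y \<omega> \<omega>' g \<epsilon> \<gamma> \<theta> m"

abbreviation \<Omega> where "\<Omega> \<equiv> dgf_width Y \<omega>"

abbreviation center where "center \<equiv> arg_min_on \<omega> Y"

definition \<kappa> :: real where "\<kappa> = \<gamma> + (1 - \<gamma>) * \<theta>"

text \<open>
  Up to the factor \<open>1 + 1 / \<gamma>\<^sup>2\<close>, an upper bound on the number of steps of a phase with gap \<open>f\<close>.
\<close>
definition ratio :: "real \<Rightarrow> real" where "ratio f = (\<Omega> * L / f)\<^sup>2"

text \<open>
  Bounds the number of search points built before a phase with gap \<open>f\<close> begins. The value is the
  sum over \<open>i \<ge> 1\<close> of \<open>(1 + 1 / \<gamma>\<^sup>2) * ratio (f / \<kappa>\<^sup>i)\<close>, as if infinitely many phases had gone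
  before, each with the least possible decrease of the gap.
\<close>
definition budget :: "real \<Rightarrow> real" where
  "budget f = (1 + 1 / \<gamma>\<^sup>2) * \<kappa>\<^sup>2 / (1 - \<kappa>\<^sup>2) * ratio f"

text \<open>
  The rise of \<open>\<omega>\<close> since the beginning of the phase, in units of the guaranteed rise
  \<open>(\<gamma> f)\<^sup>2 / (2 L\<^sup>2)\<close> per step; hence an upper bound on the completed steps of the phase.
\<close>
definition steps_spent :: "real \<Rightarrow> 'a \<Rightarrow> real" where
  "steps_spent f u = 2 * L\<^sup>2 * (\<omega> u - \<omega> center) / (\<gamma> * f)\<^sup>2"

definition good_protocol :: "'a protocol \<Rightarrow> bool" where
  "good_protocol P \<longleftrightarrow> (\<forall>(y, v)\<in>set P. y \<in> Y \<and> v = g y)"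

text \<open>
  The last conjunct for a phase or a step separates runs that start with a gap of at most
  \<open>\<epsilon>\<close>, for which the budget may exceed the claimed bound. Such a run ends at its second search point,
  because the functions of the first phase are convex combinations of the one function
  available, so that the optimal value cannot exceed \<open>\<epsilon>\<close>.
\<close>
fun invariant :: "'a nerml_state \<Rightarrow> bool" where
  "invariant (Phase P w f) \<longleftrightarrow>
     good_protocol P \<and> 0 < f \<and> f \<le> \<Omega> * L \<and> is_weights (length P) w \<and> residual Y P w = f \<and>
     real (length P) \<le> budget f \<and> (\<epsilon> < f \<or> length P = 1)"
| "invariant (Step P f u H) \<longleftrightarrow>
     good_protocol P \<and> 0 < f \<and> f \<le> \<Omega> * L \<and> (\<forall>j\<in>{1..m}. is_weights (length P) (H j)) \<and>
     u \<in> subdiff_dom Y \<omega> \<and>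
     (\<forall>y\<in>Y. (\<forall>j\<in>{1..m}. \<gamma> * f \<le> comb_fun P (H j) y) \<longrightarrow> 0 \<le> \<omega>' u \<bullet> (y - u)) \<and>
     real (length P) \<le> budget f + steps_spent f u \<and>
     (\<epsilon> < f \<or> length P = 1 \<and> residual Y P (H 1) \<le> \<epsilon>)"
| "invariant (Halt P c) \<longleftrightarrow>
     good_protocol P \<and> is_weights (length P) c \<and> residual Y P c \<le> \<epsilon> \<and>
     real (length P) \<le> max 2 (nerml_bound \<gamma> \<theta> \<Omega> L \<epsilon>)"

section \<open>The prox-center\<close>

lemma dgf_facts: "continuous_on Y \<omega>" "convex_on Y \<omega>"
  using dgf by (auto simp: dgf_def)

lemma center: "center \<in> Y" "\<And>y. y \<in> Y \<Longrightarrow> \<omega> center \<le> \<omega> y"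
  using arg_min_on_compact[OF Y(3,1) dgf_facts(1)] by blast+

lemma center_variational:
  shows "center \<in> subdiff_dom Y \<omega>" "\<And>y. y \<in> Y \<Longrightarrow> 0 \<le> \<omega>' center \<bullet> (y - center)"
proof -
  have 0: "0 \<in> subdiff Y \<omega> center" using center by (simp add: subdiff_def)
  then show "center \<in> subdiff_dom Y \<omega>" using center by (auto simp: subdiff_dom_def)
  show "0 \<le> \<omega>' center \<bullet> (y - center)" if "y \<in> Y" for y
    using selection_dominates[OF Y(3,2) dgf center(1) 0 that] by simp
qed

lemma \<omega>_le_width:
  assumes "u \<in> Y"
  shows "2 * (\<omega> u - \<omega> center) \<le> \<Omega>\<^sup>2" "0 \<le> \<Omega>"
proof -
  obtain y where y: "y \<in> Y" "\<And>z. z \<in> Y \<Longrightarrow> \<omega> z \<le> \<omega> y"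
    using continuous_attains_sup[OF Y(3,1) dgf_facts(1)] by blast
  have "(SUP y\<in>Y. \<omega> y) = \<omega> y" by (rule cSup_eq_maximum) (use y in auto)
  moreover have "(INF y\<in>Y. \<omega> y) = \<omega> center" by (rule cInf_eq_minimum) (use center in auto)
  ultimately have "\<Omega> = sqrt (2 * (\<omega> y - \<omega> center))" by (simp add: dgf_width_def)
  with y(2)[OF assms] y(2)[OF center(1)] show "2 * (\<omega> u - \<omega> center) \<le> \<Omega>\<^sup>2" "0 \<le> \<Omega>" by simp_all
qed

section \<open>Arithmetic of the step count\<close>

lemma \<kappa>: "\<gamma> < \<kappa>" "\<kappa> < 1"
proof -
  show "\<gamma> < \<kappa>" using \<gamma> \<theta> by (simp add: \<kappa>_def)
  have "0 < (1 - \<gamma>) * (1 - \<theta>)" using \<gamma> \<theta> by simp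
  then show "\<kappa> < 1" by (simp add: \<kappa>_def algebra_simps)
qed

lemma \<kappa>_sq: "0 < 1 - \<kappa>\<^sup>2" "\<gamma>\<^sup>2 \<le> \<kappa>\<^sup>2" "0 < \<kappa>"
proof -
  show "0 < \<kappa>" using \<kappa> \<gamma> by simp
  then show "0 < 1 - \<kappa>\<^sup>2" using \<kappa> power_strict_mono[of \<kappa> 1 2] by simp
  show "\<gamma>\<^sup>2 \<le> \<kappa>\<^sup>2" using \<kappa> \<gamma> by (intro power_mono) auto
qed

lemma ratio_ge_1:
  assumes "0 < f" "f \<le> \<Omega> * L"
  shows "1 \<le> ratio f"
proof -
  have "1 \<le> \<Omega> * L / f" using assms by simp
  then show ?thesis unfolding ratio_def by simp
qed

text \<open>
  With \<open>ratio f \<ge> 1\<close>, this pays for the point built by the initialization: as \<open>\<kappa> > \<gamma>\<close>,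
  already the imaginary phases before the first one are worth at least one step.
\<close>
lemma budget_first: "ratio f \<le> budget f"
proof -
  have "(1 - \<kappa>\<^sup>2) \<le> 1 * \<kappa>\<^sup>2 + 1 / \<gamma>\<^sup>2 * \<gamma>\<^sup>2"
    using \<gamma> by simp
  also have "\<dots> \<le> 1 * \<kappa>\<^sup>2 + 1 / \<gamma>\<^sup>2 * \<kappa>\<^sup>2"
    using \<kappa>_sq by (intro add_left_mono mult_left_mono) auto
  finally have "1 \<le> (1 + 1 / \<gamma>\<^sup>2) * \<kappa>\<^sup>2 / (1 - \<kappa>\<^sup>2)"
    using \<kappa>_sq(1) by (simp add: pos_le_divide_eq algebra_simps)
  then have "1 * ratio f \<le> budget f"
    unfolding budget_def by (intro mult_right_mono) (auto simp: ratio_def)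
  then show ?thesis by simp
qed

text \<open>
  The geometric series absorbs the steps of the current phase as its term for \<open>i = 0\<close>.
\<close>
lemma budget_after_phase:
  "budget f + (1 + 1 / \<gamma>\<^sup>2) * ratio f = (1 + 1 / \<gamma>\<^sup>2) / (1 - \<kappa>\<^sup>2) * ratio f"
proof -
  have "K * k / (1 - k) * r + K * r = K / (1 - k) * r" if "0 < 1 - k" for K k r :: real
    using that by (simp add: field_simps)
  from this[OF \<kappa>_sq(1)] show ?thesis unfolding budget_def .
qed

lemma budget_next_phase:
  assumes f': "0 < f'" "f' < \<kappa> * f"
  shows "budget f + (1 + 1 / \<gamma>\<^sup>2) * ratio f \<le> budget f'"
proof -
  have "0 < \<kappa> * f" using f' by linarith
  then have f: "0 < f" using \<kappa>_sq(3) by (simp add: zero_less_mult_iff)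
  have "f'\<^sup>2 \<le> (\<kappa> * f)\<^sup>2" using f' by (intro power_mono) auto
  then have "(\<Omega> * L)\<^sup>2 / (\<kappa> * f)\<^sup>2 \<le> (\<Omega> * L)\<^sup>2 / f'\<^sup>2" using f' f \<kappa>_sq(3) by (intro divide_left_mono) auto
  then have "\<kappa>\<^sup>2 * ((\<Omega> * L)\<^sup>2 / (\<kappa> * f)\<^sup>2) \<le> \<kappa>\<^sup>2 * ((\<Omega> * L)\<^sup>2 / f'\<^sup>2)" by (intro mult_left_mono) auto
  then have "ratio f \<le> \<kappa>\<^sup>2 * ratio f'" using \<kappa>_sq(3) by (simp add: ratio_def power_divide power_mult_distrib)
  then have "(1 + 1 / \<gamma>\<^sup>2) / (1 - \<kappa>\<^sup>2) * ratio f \<le> (1 + 1 / \<gamma>\<^sup>2) / (1 - \<kappa>\<^sup>2) * (\<kappa>\<^sup>2 * ratio f')"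
    using \<kappa>_sq(1) by (intro mult_left_mono) auto
  then show ?thesis unfolding budget_after_phase by (simp add: budget_def)
qed

lemma budget_bound:
  assumes "\<epsilon> < f"
  shows "budget f + (1 + 1 / \<gamma>\<^sup>2) * ratio f \<le> nerml_bound \<gamma> \<theta> \<Omega> L \<epsilon>"
proof -
  have "\<epsilon>\<^sup>2 \<le> f\<^sup>2" using assms \<epsilon> by (intro power_mono) auto
  then have "(\<Omega> * L)\<^sup>2 / f\<^sup>2 \<le> (\<Omega> * L)\<^sup>2 / \<epsilon>\<^sup>2" using \<epsilon> assms by (intro divide_left_mono) auto
  then have "ratio f \<le> \<Omega>\<^sup>2 * L\<^sup>2 / \<epsilon>\<^sup>2" by (simp add: ratio_def power_divide power_mult_distrib)
  moreover have "(1 + 1 / \<gamma>\<^sup>2) / (1 - \<kappa>\<^sup>2) = nerml_const \<gamma> \<theta>"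
    unfolding nerml_const_def \<kappa>_def[symmetric] using \<gamma> \<kappa>_sq(1) by (simp add: field_simps)
  moreover have "0 \<le> (1 + 1 / \<gamma>\<^sup>2) / (1 - \<kappa>\<^sup>2)" using \<kappa>_sq(1) by simp
  ultimately show ?thesis unfolding budget_after_phase nerml_bound_def
    by (metis mult_left_mono)
qed

lemma steps_spent_le:
  assumes "u \<in> Y"
  shows "steps_spent f u \<le> ratio f / \<gamma>\<^sup>2"
proof -
  have "steps_spent f u = 2 * (\<omega> u - \<omega> center) * (L\<^sup>2 / (\<gamma> * f)\<^sup>2)" by (simp add: steps_spent_def)
  also have "\<dots> \<le> \<Omega>\<^sup>2 * (L\<^sup>2 / (\<gamma> * f)\<^sup>2)" using \<omega>_le_width(1)[OF assms] by (intro mult_right_mono) auto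
  finally show ?thesis by (simp add: ratio_def power_divide power_mult_distrib mult.commute)
qed

text \<open>
  The additional step is the one that ends the phase. It does not move the center, so it is
  charged to \<open>ratio f \<ge> 1\<close> instead of to the rise of \<open>\<omega>\<close>.
\<close>
lemma phase_length:
  assumes "0 < f" "f \<le> \<Omega> * L" "u \<in> Y"
  shows "budget f + steps_spent f u + 1 \<le> budget f + (1 + 1 / \<gamma>\<^sup>2) * ratio f"
  using ratio_ge_1[OF assms(1,2)] steps_spent_le[OF assms(3), of f] by (simp add: algebra_simps)

section \<open>Preservation of the invariant\<close>

text \<open>
  The inequality \<open>f\<^sub>1 \<le> \<Omega> L\<close> comes from \<open>dgf_growth\<close> between the center and a point where
  the residual is attained.
\<close>
lemma invariant_start: "invariant (nerml_start Y \<omega> g)"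
proof -
  define P where "P = [(center, g center)]"
  define w where "w = unit_weight 0"
  have val: "comb_fun P w z = g center \<bullet> (center - z)" for z
    using comb_fun_unit_last[of "[]" center "g center" z] by (simp add: P_def w_def)
  have good: "good_protocol P" using center by (simp add: P_def good_protocol_def)
  have w: "is_weights (length P) w" unfolding w_def P_def by (rule is_weights_unit) simp
  obtain y where y: "y \<in> Y" "residual Y P w = comb_fun P w y"
      "\<And>z. z \<in> Y \<Longrightarrow> comb_fun P w z \<le> residual Y P w"
    using residual_attained[OF Y(3,1), where P = P and c = w] by blast
  have f0: "0 \<le> residual Y P w" using y(3)[OF center(1)] by (simp add: val)
  show ?thesis
  proof (cases "residual Y P w = 0")
    case True
    then have "nerml_start Y \<omega> g = Halt P w"
      unfolding nerml_start_def Let_def P_def[symmetric] w_def[symmetric] by simp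
    then show ?thesis using good w True \<epsilon> by (simp add: P_def)
  next
    case False
    define f where "f = residual Y P w"
    have f: "0 < f" using False f0 by (simp add: f_def)
    have "f \<le> g center \<bullet> (center - y)" using y(2) by (simp add: f_def val)
    note growth = dgf_growth[OF Y(3,2) nrm dgf center_variational(1) y(1) _ f this, of L]
    have L: "0 < L" using growth(1) g_bound center(1) by blast
    have "\<omega> center + f\<^sup>2 / (2 * L\<^sup>2) \<le> \<omega> y"
      using growth(2) g_bound center(1) center_variational(2)[OF y(1)] by force
    then have "f\<^sup>2 / L\<^sup>2 \<le> \<Omega>\<^sup>2" using \<omega>_le_width(1)[OF y(1)] by (simp add: field_simps)
    then have "f\<^sup>2 \<le> (\<Omega> * L)\<^sup>2" using L by (simp add: pos_divide_le_eq power_mult_distrib)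
    then have fL: "f \<le> \<Omega> * L"
      by (rule power2_le_imp_le) (use L \<omega>_le_width(2)[OF y(1)] in simp)
    have "nerml_start Y \<omega> g = Phase P w f"
      using False unfolding nerml_start_def Let_def f_def P_def[symmetric] w_def[symmetric] by simp
    moreover have "1 \<le> budget f" using ratio_ge_1[OF f fL] budget_first[of f] by linarith
    moreover have "length P = 1" by (simp add: P_def)
    ultimately show ?thesis using good f fL w by (simp add: f_def)
  qed
qed

lemma good_protocol_append:
  "good_protocol P \<Longrightarrow> u \<in> Y \<Longrightarrow> good_protocol (P @ [(u, g u)])"
  by (auto simp: good_protocol_def)

lemma subdiff_domD: "u \<in> subdiff_dom Y \<omega> \<Longrightarrow> u \<in> Y"
  by (simp add: subdiff_dom_def)

lemma new_bundle_is_weights: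
  assumes "\<forall>j\<in>{1..m}. is_weights (length P) (H j)" "j \<in> {1..m + 1}"
  shows "is_weights (length (P @ [x])) ((H(m + 1 := unit_weight (length P))) j)"
  using assms by (cases "j = m + 1") (auto intro: is_weights_unit is_weights_Suc)

lemma new_bundle_old:
  assumes "\<forall>j\<in>{1..m}. is_weights (length P) (H j)" "j \<in> {1..m}"
  shows "comb_fun (P @ [x]) ((H(m + 1 := unit_weight (length P))) j) = comb_fun P (H j)"
proof -
  have "(H(m + 1 := unit_weight (length P))) j = H j" using assms(2) by simp
  then show ?thesis using assms by (auto intro!: comb_fun_append simp: is_weights_def)
qed

text \<open>
  Only case A can follow a first gap of at most \<open>\<epsilon>\<close>, as the minimum over the bundle is at most
  its first member.
\<close>
lemma gap_exceeds_tolerance: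
  assumes inv: "invariant (Step P f u H)"
    and gt: "\<epsilon> < opt_value Y (m + 1) (P @ [(u, g u)]) (H(m + 1 := unit_weight (length P)))"
  shows "\<epsilon> < f"
proof (rule ccontr)
  assume "\<not> \<epsilon> < f"
  then have "residual Y P (H 1) \<le> \<epsilon>" using inv by simp
  moreover have "residual Y (P @ [(u, g u)]) ((H(m + 1 := unit_weight (length P))) 1) = residual Y P (H 1)"
    unfolding residual_def using inv m by (subst new_bundle_old) auto
  ultimately show False
    using gt opt_value_le_residual[OF Y(3,1), of 1 "m + 1" "P @ [(u, g u)]" "H(m + 1 := unit_weight (length P))"]
    by simp
qed

lemma invariant_step:
  assumes "trans s s'" "invariant s"
  shows "invariant s'"
  using assms
proof (cases rule: nerml_trans.cases)
  case (init_phase P H f w)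
  have inv: "invariant (Phase P w f)" using assms(2) init_phase(1) by simp
  have "\<epsilon> < f \<or> length P = 1 \<and> residual Y P (H 1) \<le> \<epsilon>"
  proof (cases "\<epsilon> < f")
    case False
    then have 1: "length P = 1" using inv by simp
    have "is_weights 1 (H 1)" "is_weights 1 w" using init_phase(3) m inv 1 by auto
    then have "H 1 = w" using is_weights_one by metis
    with inv 1 False show ?thesis by auto
  qed simp
  then show ?thesis unfolding init_phase(2)
    using inv init_phase(3) center_variational by (auto simp: steps_spent_def)
next
  case (case_A P' P u H' H c f)
  have inv: "invariant (Step P f u H)" using assms(2) case_A(1) by simp
  then have uY: "u \<in> Y" by (simp add: subdiff_domD)
  have len: "length P' = length P + 1" using case_A by simp
  have lenb: "real (length P') \<le> max 2 (nerml_bound \<gamma> \<theta> \<Omega> L \<epsilon>)"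
  proof (cases "\<epsilon> < f")
    case True
    have "real (length P) \<le> budget f + steps_spent f u" using inv by simp
    with budget_bound[OF True] phase_length[of f u] inv uY
    have "real (length P') \<le> nerml_bound \<gamma> \<theta> \<Omega> L \<epsilon>" unfolding len by simp
    then show ?thesis by simp
  next
    case False
    with inv show ?thesis unfolding len by simp
  qed
  have "is_weights (length P') (H' j)" if "j \<in> {1..m + 1}" for j
    unfolding case_A(3,4) by (rule new_bundle_is_weights[OF _ that]) (use inv in simp)
  then have "is_weights (length P') c" by (rule opt_comb_is_weights[OF case_A(5)])
  moreover have "residual Y P' c \<le> \<epsilon>" using case_A(5,6) by (auto simp: opt_comb_def)
  moreover have "good_protocol P'" using inv uY good_protocol_append case_A(3) by simp
  ultimately show ?thesis using lenb unfolding case_A(2) invariant.simps by blast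
next
  case (case_B P' P u H' H l f c)
  have inv: "invariant (Step P f u H)" using assms(2) case_B(1) by simp
  then have uY: "u \<in> Y" by (simp add: subdiff_domD)
  define f' where "f' = opt_value Y (m + 1) P' H'"
  have f': "\<epsilon> < f'" "f' < \<kappa> * f"
    using case_B by (auto simp: f'_def \<kappa>_def algebra_simps)
  then have f'0: "0 < f'" using \<epsilon> by linarith
  have len: "length P' = length P + 1" using case_B by simp
  have lenb: "real (length P') \<le> budget f'"
    using budget_next_phase[OF f'0 f'(2)] phase_length[of f u] inv uY unfolding len by simp
  have "is_weights (length P') (H' j)" if "j \<in> {1..m + 1}" for j
    unfolding case_B(3,4) by (rule new_bundle_is_weights[OF _ that]) (use inv in simp)
  then have "is_weights (length P') c" by (rule opt_comb_is_weights[OF case_B(6)])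
  moreover have "residual Y P' c = f'" using case_B(6) by (auto simp: opt_comb_def f'_def)
  moreover have "good_protocol P'" using inv uY good_protocol_append case_B(3) by simp
  moreover have "f' \<le> \<Omega> * L"
  proof -
    have "0 < f" "f \<le> \<Omega> * L" using inv by simp_all
    moreover from this have "\<kappa> * f \<le> 1 * f" using \<kappa>(2) by (intro mult_right_mono) simp_all
    ultimately show ?thesis using f'(2) by linarith
  qed
  ultimately show ?thesis using lenb f'(1) f'0 unfolding case_B(2) f'_def[symmetric] invariant.simps by blast
next
  case (case_C P' P u H' H l f u' \<mu> H'')
  have inv: "invariant (Step P f u H)" using assms(2) case_C(1) by simp
  then have uY: "u \<in> Y" by (simp add: subdiff_domD)
  have f: "0 < f" "f \<le> \<Omega> * L" using inv by auto
  have l: "0 < l" using f \<gamma> case_C(5) by simp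
  have "1 \<le> m + 1" by simp
  from opt_value_attained[OF Y(3,1) this] obtain z where z: "z \<in> Y"
    "\<And>j. j \<in> {1..m+1} \<Longrightarrow> opt_value Y (m + 1) P' H' \<le> comb_fun P' (H' j) z" by metis
  have "l < opt_value Y (m + 1) P' H'"
  proof -
    have "0 < \<theta> * (f - l)" using \<gamma> \<theta> f unfolding case_C(5) by simp
    with case_C(7) show ?thesis by linarith
  qed
  then have slater: "l < comb_fun P' (H' j) z" if "j \<in> {1..m+1}" for j using z(2)[OF that] by linarith
  have u'd: "u' \<in> subdiff_dom Y \<omega>"
    unfolding case_C(8) by (rule kkt_exists(1)[OF Y(3,2) dgf z(1) slater])
  have "z \<in> level_set Y (m + 1) P' H' l" using z slater by (auto simp: level_set_def less_imp_le)
  then have u': "u' \<in> level_set Y (m + 1) P' H' l"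
    unfolding case_C(8) by (intro level_set_arg_min[OF Y(3) dgf_facts(1)]) blast
  have u'Y: "u' \<in> Y" using u' by (simp add: level_set_def)
  have u'l: "l \<le> comb_fun P' (H' j) u'" if "j \<in> {1..m+1}" for j using u' that by (simp add: level_set_def)
  have "l \<le> comb_fun P (H j) u'" if "j \<in> {1..m}" for j
    using u'l[of j] that new_bundle_old[of P H j "(u, g u)"] inv case_C(3,4) by auto
  then have vi: "0 \<le> \<omega>' u \<bullet> (u' - u)" using inv u'Y case_C(5) by auto
  \<comment> \<open>The function built at the old center is the last member of the bundle.\<close>
  have cut: "l \<le> g u \<bullet> (u - u')" using u'l[of "m+1"] unfolding case_C(3,4) by (simp add: comb_fun_unit_last)
  have gu: "dual_norm nrm (g u) \<le> L" using g_bound uY by blast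
  have "u \<in> subdiff_dom Y \<omega>" using inv by simp
  note growth = dgf_growth[OF Y(3,2) nrm dgf this u'Y gu l cut]
  have "\<omega> u + l\<^sup>2 / (2 * L\<^sup>2) \<le> \<omega> u'" using growth(2) vi by linarith
  then have "2 * L\<^sup>2 * (\<omega> u - \<omega> center) + l\<^sup>2 \<le> 2 * L\<^sup>2 * (\<omega> u' - \<omega> center)"
    using growth(1) by (simp add: field_simps)
  then have "(2 * L\<^sup>2 * (\<omega> u - \<omega> center) + l\<^sup>2) / l\<^sup>2 \<le> 2 * L\<^sup>2 * (\<omega> u' - \<omega> center) / l\<^sup>2"
    by (rule divide_right_mono) simp
  then have "steps_spent f u + 1 \<le> steps_spent f u'"
    unfolding steps_spent_def case_C(5)[symmetric] using l by (simp add: add_divide_distrib)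
  then have lenb: "real (length P') \<le> budget f + steps_spent f u'" using inv case_C(3) by simp
  have "is_weights (length P') (H' j)" if "j \<in> {1..m + 1}" for j
    unfolding case_C(3,4) by (rule new_bundle_is_weights[OF _ that]) (use inv in simp)
  then have "\<forall>j\<in>{1..m}. is_weights (length P') (H'' j)"
    using bundle_update_is_weights[OF case_C(10)] case_C(9) unfolding kkt_mult_def by blast
  moreover have "\<forall>y\<in>Y. (\<forall>j\<in>{1..m}. \<gamma> * f \<le> comb_fun P' (H'' j) y) \<longrightarrow> 0 \<le> \<omega>' u' \<bullet> (y - u')"
    using bundle_update_variational[OF m case_C(10,9)] case_C(5) by blast
  moreover have "\<epsilon> < f" using gap_exceeds_tolerance[OF inv] case_C(3,4,6) by simp
  moreover have "good_protocol P'" using inv uY good_protocol_append case_C(3) by simp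
  ultimately show ?thesis using lenb f u'd unfolding case_C(2) invariant.simps by blast
qed

lemma invariant_reachable: "trans\<^sup>*\<^sup>* (nerml_start Y \<omega> g) s \<Longrightarrow> invariant s"
  by (induction rule: rtranclp_induct) (auto intro: invariant_start invariant_step)

section \<open>Progress and termination\<close>

lemma progress:
  assumes "invariant s" "\<not> halted s"
  shows "\<exists>s'. trans s s'"
proof (cases s)
  case (Phase P w f)
  have inv: "0 < f" "is_weights (length P) w" "residual Y P w = f" using assms Phase by auto
  obtain y where y: "y \<in> Y" "residual Y P w = comb_fun P w y"
    using residual_attained[OF Y(3,1), where P = P and c = w] by blast
  have "\<gamma> * f < 1 * f" using inv \<gamma> by (intro mult_strict_right_mono) auto
  then have "y \<in> {y\<in>Y. \<forall>j\<in>{1..m}. \<gamma> * f < comb_fun P w y}" using y inv by auto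
  then have "closure {y\<in>Y. \<forall>j\<in>{1..m}. \<gamma> * f < comb_fun P w y} \<noteq> {}" by auto
  then show ?thesis unfolding Phase
    using nerml_trans.init_phase[of m P "\<lambda>_. w"] inv by blast
next
  case (Step P f u H)
  have f: "0 < f" using assms Step by simp
  define P' where "P' = P @ [(u, g u)]"
  define H' where "H' = H(m + 1 := unit_weight (length P))"
  define l where "l = \<gamma> * f"
  define o' where "o' = opt_value Y (m + 1) P' H'"
  have m1: "1 \<le> m + 1" by simp
  obtain c where c: "opt_comb Y (m + 1) P' H' c" using opt_comb_exists[OF Y(3,2,1) m1] by blast
  consider "o' \<le> \<epsilon>" | "\<epsilon> < o'" "o' < l + \<theta> * (f - l)" | "\<epsilon> < o'" "l + \<theta> * (f - l) \<le> o'" by linarith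
  then show ?thesis
  proof cases
    case 1
    then show ?thesis unfolding Step o'_def using nerml_trans.case_A[where g = g and u = u, OF P'_def H'_def c] by blast
  next
    case 2
    then show ?thesis unfolding Step o'_def using nerml_trans.case_B[where g = g and u = u, OF P'_def H'_def l_def c] by blast
  next
    case 3
    from opt_value_attained[OF Y(3,1) m1] obtain z where z: "z \<in> Y"
      "\<And>j. j \<in> {1..m+1} \<Longrightarrow> o' \<le> comb_fun P' (H' j) z" unfolding o'_def by metis
    have "l < o'"
    proof -
      have "0 < \<theta> * (f - l)" using \<gamma> \<theta> f by (simp add: l_def)
      with 3 show ?thesis by linarith
    qed
    then have slater: "l < comb_fun P' (H' j) z" if "j \<in> {1..m+1}" for j using z(2)[OF that] by linarith
    have "\<exists>\<mu>. kkt_mult Y \<omega>' (m + 1) P' H' l (arg_min_on \<omega> (level_set Y (m + 1) P' H' l)) \<mu>"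
      by (rule kkt_exists(2)[OF Y(3,2) dgf z(1) slater])
    then obtain \<mu> where
      \<mu>: "kkt_mult Y \<omega>' (m + 1) P' H' l (arg_min_on \<omega> (level_set Y (m + 1) P' H' l)) \<mu>" by blast
    obtain H'' where "bundle_update m \<mu> H' H''" using bundle_update_exists by blast
    from nerml_trans.case_C[where g = g and u = u, OF P'_def H'_def l_def 3[unfolded o'_def] refl \<mu> this]
    show ?thesis unfolding Step by blast
  qed
qed (use assms in auto)

text \<open>
  A step appends one entry to the protocol, worth two units, and may lose the unit that marks a
  state in the middle of a phase; the beginning of a phase gains that unit.
\<close>
fun rank :: "'a nerml_state \<Rightarrow> nat" where
  "rank (Phase P w f) = 2 * length P"
| "rank (Step P f u H) = 2 * length P + 1"
| "rank (Halt P w) = 2 * length P"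

lemma rank_step: "trans s s' \<Longrightarrow> rank s < rank s'"
  by (cases rule: nerml_trans.cases) auto

lemma rank_bounded:
  assumes "invariant s"
  shows "real (rank s) \<le> 2 * max 2 (nerml_bound \<gamma> \<theta> \<Omega> L \<epsilon>) + 1"
proof (cases s)
  case (Phase P w f)
  show ?thesis
  proof (cases "\<epsilon> < f")
    case True
    have "0 \<le> (1 + 1 / \<gamma>\<^sup>2) * ratio f" by (simp add: ratio_def)
    with budget_bound[OF True] assms Phase
    have "real (length P) \<le> nerml_bound \<gamma> \<theta> \<Omega> L \<epsilon>" by simp
    then show ?thesis unfolding Phase by simp
  qed (use assms Phase in auto)
next
  case (Step P f u H)
  show ?thesis
  proof (cases "\<epsilon> < f")
    case True
    have "real (length P) \<le> budget f + steps_spent f u" "0 < f" "f \<le> \<Omega> * L" "u \<in> Y"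
      using assms Step by (auto simp: subdiff_domD)
    with budget_bound[OF True] phase_length[of f u]
    have "real (length P) \<le> nerml_bound \<gamma> \<theta> \<Omega> L \<epsilon>" by simp
    then show ?thesis unfolding Step by simp
  qed (use assms Step in auto)
qed (use assms in auto)

lemma no_infinite_run:
  "\<nexists>\<sigma>. \<sigma> (0::nat) = nerml_start Y \<omega> g \<and> (\<forall>n. trans (\<sigma> n) (\<sigma> (Suc n)))"
proof
  assume "\<exists>\<sigma>. \<sigma> (0::nat) = nerml_start Y \<omega> g \<and> (\<forall>n. trans (\<sigma> n) (\<sigma> (Suc n)))"
  then obtain \<sigma> where \<sigma>: "\<sigma> (0::nat) = nerml_start Y \<omega> g" "\<And>n. trans (\<sigma> n) (\<sigma> (Suc n))" by blast
  have inv: "invariant (\<sigma> n)" for n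
    by (induction n) (use \<sigma> invariant_start invariant_step in auto)
  have "n \<le> rank (\<sigma> n)" for n
    by (induction n) (use rank_step[OF \<sigma>(2)] in \<open>auto intro: Suc_leI le_less_trans\<close>)
  then have "real n \<le> 2 * max 2 (nerml_bound \<gamma> \<theta> \<Omega> L \<epsilon>) + 1" for n
    using rank_bounded[OF inv[of n]] by (meson of_nat_mono order_trans)
  moreover obtain n where "2 * max 2 (nerml_bound \<gamma> \<theta> \<Omega> L \<epsilon>) + 1 < real n"
    using reals_Archimedean2 by blast
  ultimately show False by (meson not_le)
qed

end

theorem proposition3p3:
  fixes Y :: "'a::euclidean_space set"
    and nrm :: "'a \<Rightarrow> real"
    and \<omega> :: "'a \<Rightarrow> real"
    and \<omega>' :: "'a \<Rightarrow> 'a"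
    and g :: "'a \<Rightarrow> 'a"
    and L \<epsilon> \<gamma> \<theta> :: real
    and m :: nat
  assumes "Y \<noteq> {}" "convex Y" "compact Y"
    and "is_norm nrm"
    and "dgf Y nrm \<omega> \<omega>'"
    and "\<forall>y\<in>Y. dual_norm nrm (g y) \<le> L"
    and "0 < \<epsilon>"
    and "0 < \<gamma>" "\<gamma> < 1"
    and "0 < \<theta>" "\<theta> < 1"
    and "1 \<le> m"
  shows
    "(\<nexists>\<sigma>. \<sigma> (0::nat) = nerml_start Y \<omega> g \<and>
          (\<forall>n. nerml_trans Y \<omega> \<omega>' g \<epsilon> \<gamma> \<theta> m (\<sigma> n) (\<sigma> (Suc n)))) \<and>
     (\<forall>s. (nerml_trans Y \<omega> \<omega>' g \<epsilon> \<gamma> \<theta> m)\<^sup>*\<^sup>* (nerml_start Y \<omega> g) s \<longrightarrow>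
          halted s \<or> (\<exists>s'. nerml_trans Y \<omega> \<omega>' g \<epsilon> \<gamma> \<theta> m s s')) \<and>
     (\<forall>P lam. (nerml_trans Y \<omega> \<omega>' g \<epsilon> \<gamma> \<theta> m)\<^sup>*\<^sup>* (nerml_start Y \<omega> g) (Halt P lam) \<longrightarrow>
          (\<forall>(y, v)\<in>set P. y \<in> Y \<and> v = g y) \<and>
          (\<forall>i<length P. 0 \<le> lam i) \<and> (\<Sum>i<length P. lam i) = 1 \<and>
          residual Y P lam \<le> \<epsilon> \<and>
          real (length P) \<le> max 2 (nerml_bound \<gamma> \<theta> (dgf_width Y \<omega>) L \<epsilon>))"
proof -
  interpret nerml Y nrm \<omega> \<omega>' g L \<epsilon> \<gamma> \<theta> m
    using assms by unfold_locales
  show ?thesis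
  proof (intro conjI[OF no_infinite_run] conjI allI impI)
    show "halted s \<or> (\<exists>s'. trans s s')" if "trans\<^sup>*\<^sup>* (nerml_start Y \<omega> g) s" for s
      using progress invariant_reachable[OF that] by blast
  next
    fix P lam assume "trans\<^sup>*\<^sup>* (nerml_start Y \<omega> g) (Halt P lam)"
    from invariant_reachable[OF this]
    have inv: "good_protocol P" "is_weights (length P) lam" "residual Y P lam \<le> \<epsilon>"
      "real (length P) \<le> max 2 (nerml_bound \<gamma> \<theta> \<Omega> L \<epsilon>)" by auto
    show "\<forall>(y, v)\<in>set P. y \<in> Y \<and> v = g y" using inv(1) by (simp add: good_protocol_def)
    show "0 \<le> lam i" if "i < length P" for i using inv(2) by (simp add: is_weights_def)
    show "(\<Sum>i<length P. lam i) = 1" using inv(2) by (simp add: is_weights_def)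
    show "residual Y P lam \<le> \<epsilon>" "real (length P) \<le> max 2 (nerml_bound \<gamma> \<theta> \<Omega> L \<epsilon>)"
      using inv by auto
  qed
qed

end
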